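(* For every $0$-framed knot $\mathcal K$ in $S^3$, the loop expansion of the colored Jones function equals the unified invariant: in $\mathbb Q[\alpha][[h]]$ (with $q=e^h$), $$J_\alpha(q^2,\mathcal K)=F_\infty(q,q^\alpha,\mathcal K).$$
   Context: Knots are oriented, framed, in $S^3$. $\{n\}=q^n-q^{-n}$, $[n]=\{n\}/\{1\}$, $[n]!=\prod_{i=1}^n[i]$, $\binom{n}{k}_q=\frac{[n]!}{[n-k]![k]!}$. $A$ is a formal variable, also written $q^\alpha$; $\{\alpha+k\}_q=q^kA-q^{-k}A^{-1}$ and $\{\alpha+k;n\}_q=\prod_{i=0}^{n-1}\{\alpha+k-i\}_q$. $R=\mathbb Z[q^{\pm1},A^{\pm1}]$, $I_n\subset R$ is the ideal generated by $\{\alpha+l;n\}_q$, $l\in\mathbb Z$, and $\widehat R=\varprojlim_n R/I_n$, a subring of $\mathbb Q[\alpha][[h]]$ via $q=e^h$, $A=e^{\alpha h}$. Colored Jones polynomials. $J_n(q^2,\mathcal K)\in\mathbb Z[q^{\pm2}]$ is the scalar by which the Reshetikhin–Turaev operator of a 1-1 tangle with $0$-framed closure $\mathcal K$ acts on the $(n+1)$-dimensional irreducible representation of quantum $\mathfrak{sl}_2$, using $q^{\frac{H\otimes H}{2}}\sum_{n\ge 0}\frac{\{1\}^nq^{n(n-1)/2}}{[n]!}E^n\otimes F^n$ as $R$-matrix and pivotal element $K=q^H$, where $[E,F]=\frac{K-K^{-1}}{q-q^{-1}}$ (so $J_n(\text{unknot})=1$). Loop expansion. By Rozansky there are Laurent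 polynomials $P_k(X)\in\mathbb Q[X,X^{-1}]$, depending on $\mathcal K$, such that for all $n$, $J_n(e^{2h},\mathcal K)=\sum_{k\ge0}\frac{P_k(e^{2nh})}{A_{\mathcal K}(e^{2nh})^{2k+1}}h^k$ in $\mathbb Q[[h]]$, where $A_{\mathcal K}(t)$ is the Alexander polynomial (normalized by $A_{\mathcal K}(1)=1$, $A_{\text{unknot}}=1$, $A_{\mathcal K}(t)=A_{\mathcal K}(t^{-1})$). Put $J_\alpha(q^2,\mathcal K)=\sum_{k\ge0}\frac{P_k(e^{2\alpha h})}{A_{\mathcal K}(e^{2\alpha h})^{2k+1}}h^k\in\mathbb Q[\alpha][[h]]$. Unified invariant. Let $D$ be a diagram of a 1-1 tangle with closure $\mathcal K$ (blackboard framing), open strand running from bottom to top, all crossings drawn with both strands oriented upward; number the crossings $1,\dots,N$. For $(i_1,\dots,i_N)\in\mathbb N^N$ label the edges of $D$: the bottom and top edges have label $0$; at the $k$-th crossing the under-strand has incoming label $a_k$ and outgoing label $a_k+i_k$, the over-strand has incoming label $b_k$ and outgoing label $b_k-i_k$ (terms with a negative label are zero). Let $j=1,\dots,S$ run over the local maxima (caps) and minima (cups) of $D$ traversed from left to right, $\epsilon_j$ the label there, $\sigma_j=+1$ for a cap, $-1$ for a cup. Put $$D(i_1,\dots,i_N)=\prod_{j=1}^Sq^{\sigma_j(\alpha-2\epsilon_j)}\prod_{k\,\mathrm{pos}}q^{\frac{i_k(i_k-1)}2}\binom{a_k+i_k}{i_k}_q\{\alpha-a_k;i_k\}_q\,q^{-(a_k+b_k)\alpha}q^{2(a_k+i_k)(b_k-i_k)}$$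 $$\times\prod_{k\,\mathrm{neg}}(-1)^{i_k}q^{-\frac{i_k(i_k-1)}2}\binom{a_k+i_k}{i_k}_q\{\alpha-a_k;i_k\}_q\,q^{(a_k+b_k)\alpha}q^{-2a_kb_k}.$$ For $0$-framed $\mathcal K$, $F_\infty(q,A,\mathcal K)=\sum_{i_1,\dots,i_N=0}^{\infty}D(i_1,\dots,i_N)\in\widehat R$, independent of $D$. *)

theory Defs
  imports
    "HOL-Library.Poly_Mapping"
    "HOL-Computational_Algebra.Computational_Algebra"
    "Jordan_Normal_Form.Determinant"
begin

section \<open>Diagrams of 1-1 tangles\<close>

text \<open>
  Diagrams are in Morse position with respect to the height and are read from bottom to top.
  At a regular level the diagram meets the horizontal line in a word of orientations.  Each layer
  contains one elementary piece, with vertical strands \<open>u\<close> to its left and \<open>v\<close> to its right.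

  At a crossing both strands point upwards.  At \<open>Pos\<close> the over-strand runs from bottom left to top
  right, at \<open>Neg\<close> from bottom right to top left.  \<open>CapLR\<close>, \<open>CupLR\<close> (\<open>CapRL\<close>, \<open>CupRL\<close>) are the local
  maxima and minima which the strand traverses from left to right (from right to left).
\<close>

datatype orientation = Up | Down

datatype elem = Pos | Neg | CapLR | CapRL | CupLR | CupRL

type_synonym layer = "orientation list \<times> elem \<times> orientation list"

type_synonym diagram = "layer list"

fun lower :: "elem \<Rightarrow> orientation list" where
  "lower Pos = [Up, Up]"
| "lower Neg = [Up, Up]"
| "lower CapLR = [Up, Down]"
| "lower CapRL = [Down, Up]"
| "lower CupLR = []"
| "lower CupRL = []"

fun upper :: "elem \<Rightarrow> orientation list" where
  "upper Pos = [Up, Up]"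
| "upper Neg = [Up, Up]"
| "upper CapLR = []"
| "upper CapRL = []"
| "upper CupLR = [Down, Up]"
| "upper CupRL = [Up, Down]"

fun tangle :: "diagram \<Rightarrow> orientation list \<Rightarrow> orientation list \<Rightarrow> bool" where
  "tangle [] w w' \<longleftrightarrow> w = w'"
| "tangle ((u, e, v) # D) w w' \<longleftrightarrow> w = u @ lower e @ v \<and> tangle D (u @ upper e @ v) w'"

definition elem_at :: "diagram \<Rightarrow> nat \<Rightarrow> elem" where
  "elem_at D l = fst (snd (D ! l))"

definition left_width :: "diagram \<Rightarrow> nat \<Rightarrow> nat" where
  "left_width D l = length (fst (D ! l))"

text \<open>
  The open strand is followed from the bottom endpoint.  The state \<open>(l, x, d)\<close> means that it passes
  the level just below layer \<open>l\<close> at the position \<open>x\<close>, counted from the left, in the direction \<open>d\<close>.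
  In a crossing, cap or cup at the positions \<open>p\<close>, \<open>p + 1\<close> the strand leaves at the other position.
\<close>

fun step :: "diagram \<Rightarrow> nat \<times> nat \<times> orientation \<Rightarrow> nat \<times> nat \<times> orientation" where
  "step D (l, x, Up) =
     (if l \<ge> length D then (l, x, Up)
      else let e = elem_at D l; p = left_width D l in
        if x < p then (Suc l, x, Up)
        else if x < p + length (lower e) then
          (if upper e = [] then (l, p + (1 - (x - p)), Down) else (Suc l, p + (1 - (x - p)), Up))
        else (Suc l, x - length (lower e) + length (upper e), Up))"
| "step D (l, x, Down) =
     (let e = elem_at D (l - 1); p = left_width D (l - 1) in
        if x < p then (l - 1, x, Down)
        else if x < p + length (upper e) then (l, p + (1 - (x - p)), Up)
        else (l - 1, x - length (upper e) + length (lower e), Down))"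

definition visit :: "diagram \<Rightarrow> nat \<Rightarrow> nat \<times> nat \<times> orientation" where
  "visit D m = (step D ^^ m) (0, 0, Up)"

definition strand_length :: "diagram \<Rightarrow> nat" where
  "strand_length D = (LEAST m. fst (visit D m) = length D)"

definition time :: "diagram \<Rightarrow> nat \<times> nat \<times> orientation \<Rightarrow> nat" where
  "time D s = (LEAST m. visit D m = s)"

text \<open>
  The closure is a knot if and only if the open strand is the only component, that is, if it visits
  every point of every level.
\<close>

definition one_component :: "diagram \<Rightarrow> bool" where
  "one_component D \<longleftrightarrow>
     (\<forall>l < length D. \<forall>x < left_width D l + length (lower (elem_at D l)) + length (snd (snd (D ! l))).
        \<exists>m \<le> strand_length D. \<exists>d. visit D m = (l, x, d))"

definition knot_diagram :: "diagram \<Rightarrow> bool" where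
  "knot_diagram D \<longleftrightarrow> tangle D [Up] [Up] \<and> one_component D"

text \<open>The \<open>k\<close>-th crossing is in the layer \<open>crossings D ! k\<close>.\<close>

definition crossings :: "diagram \<Rightarrow> nat list" where
  "crossings D = filter (\<lambda>l. elem_at D l \<in> {Pos, Neg}) [0..<length D]"

definition writhe :: "diagram \<Rightarrow> int" where
  "writhe D = (\<Sum>l\<leftarrow>crossings D. if elem_at D l = Pos then 1 else - 1)"

text \<open>The times at which the strand is about to run through the crossing in layer \<open>l\<close>.\<close>

definition over_time :: "diagram \<Rightarrow> nat \<Rightarrow> nat" where
  "over_time D l = time D (l, left_width D l + (if elem_at D l = Pos then 0 else 1), Up)"

definition under_time :: "diagram \<Rightarrow> nat \<Rightarrow> nat" where
  "under_time D l = time D (l, left_width D l + (if elem_at D l = Pos then 1 else 0), Up)"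


section \<open>Power series in $h$ and Laurent polynomials\<close>

text \<open>
  A ring homomorphism \<open>\<iota>\<close> from the rationals to the coefficient ring is passed explicitly, in order
  to treat \<open>\<rat>[[h]]\<close> (\<open>\<iota> = id\<close>) and \<open>\<rat>[\<alpha>][[h]]\<close> (\<open>\<iota> r = [:r:]\<close>) uniformly.
  Here \<open>exp_h \<iota> c\<close> is $e^{ch}$.
\<close>

definition exp_h :: "(rat \<Rightarrow> 'a) \<Rightarrow> 'a \<Rightarrow> 'a::comm_ring_1 fps" where
  "exp_h \<iota> c = Abs_fps (\<lambda>m. \<iota> (1 / fact m) * c ^ m)"

text \<open>A Laurent polynomial is the finitely supported function of its coefficients.\<close>

type_synonym 'a laurent = "int \<Rightarrow>\<^sub>0 'a"

text \<open>The value of a rational Laurent polynomial at $X = e^{ch}$.\<close>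

definition laurent_exp :: "(rat \<Rightarrow> 'a) \<Rightarrow> 'a \<Rightarrow> rat laurent \<Rightarrow> 'a::comm_ring_1 fps" where
  "laurent_exp \<iota> c f =
     (\<Sum>j \<in> Poly_Mapping.keys f. fps_const (\<iota> (Poly_Mapping.lookup f j)) * exp_h \<iota> (of_int j * c))"


section \<open>The Alexander polynomial\<close>

text \<open>
  The strand is cut at all passes through crossings, over-passes included, into the edges
  \<open>0, \<dots>, 2 * N\<close>; \<open>edge D m\<close> is the edge visited at time \<open>m\<close>.
\<close>

definition edge :: "diagram \<Rightarrow> nat \<Rightarrow> nat" where
  "edge D m = card {j. j < m \<and> (\<exists>l \<in> set (crossings D). j = over_time D l \<or> j = under_time D l)}"

text \<open>
  The Alexander matrix (Fox calculus) of the Wirtinger presentation with the edges as generators.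
  The crossing \<open>k\<close> yields the relations \<open>o' = o\<close> and \<open>x' = o x o\<^sup>-\<^sup>1\<close> (positive crossing) or
  \<open>x' = o\<^sup>-\<^sup>1 x o\<close> (negative crossing), where \<open>o, o'\<close> and \<open>x, x'\<close> are the incoming and outgoing edges of
  the over- and under-strand; these give the rows \<open>2 * k\<close> and \<open>2 * k + 1\<close>.  The column of edge \<open>0\<close>
  is deleted.
\<close>

definition alexander_matrix :: "diagram \<Rightarrow> int laurent mat" where
  "alexander_matrix D =
     mat (2 * length (crossings D)) (2 * length (crossings D)) (\<lambda>(r, c).
       let l = crossings D ! (r div 2);
           x = edge D (under_time D l);
           ov = edge D (over_time D l);
           t = Poly_Mapping.single (if elem_at D l = Pos then 1 else - 1) 1;
           \<delta> = (\<lambda>y. of_bool (y = Suc c))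
       in if even r then \<delta> ov - \<delta> (Suc ov)
          else t * \<delta> x + (1 - t) * \<delta> ov - \<delta> (Suc x))"

definition alexander :: "diagram \<Rightarrow> int laurent" where
  "alexander D = (THE A.
     (\<exists>k. \<exists>e \<in> {1, - 1}. A = Poly_Mapping.single k e * det (alexander_matrix D)) \<and>
     (\<Sum>j \<in> Poly_Mapping.keys A. Poly_Mapping.lookup A j) = 1 \<and>
     (\<forall>j. Poly_Mapping.lookup A (- j) = Poly_Mapping.lookup A j))"


section \<open>The Reshetikhin--Turaev operator\<close>

text \<open>
  The parameter is \<open>s = q\<^sup>1\<^sup>/\<^sup>2\<close>, in a field where \<open>q\<close> is not a root of unity; square roots of \<open>q\<close> occur
  in \<open>q\<^sup>H\<^sup>\<otimes>\<^sup>H\<^sup>/\<^sup>2\<close> on odd weights.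
\<close>

definition qnum :: "'a::field \<Rightarrow> int \<Rightarrow> 'a" where
  "qnum s k = (s powi (2 * k) - s powi (- 2 * k)) / (s powi 2 - s powi (- 2))"

definition qnum_fact :: "'a::field \<Rightarrow> nat \<Rightarrow> 'a" where
  "qnum_fact s n = (\<Prod>i = 1..n. qnum s (int i))"

text \<open>
  The irreducible module of highest weight \<open>n\<close> with basis \<open>v\<^sub>0, \<dots>, v\<^sub>n\<close>, such that \<open>v\<^sub>j\<close> has weight
  \<open>n - 2j\<close>, \<open>E v\<^sub>j = v\<^sub>j\<^sub>-\<^sub>1\<close> and \<open>F v\<^sub>j = [j + 1] [n - j] v\<^sub>j\<^sub>+\<^sub>1\<close>.
\<close>

definition E_mat :: "nat \<Rightarrow> 'a::field mat" where
  "E_mat n = mat (n + 1) (n + 1) (\<lambda>(i, j). of_bool (Suc i = j))"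

definition F_mat :: "'a::field \<Rightarrow> nat \<Rightarrow> 'a mat" where
  "F_mat s n = mat (n + 1) (n + 1)
     (\<lambda>(i, j). if i = Suc j then qnum s (int j + 1) * qnum s (int n - int j) else 0)"

definition weight :: "nat \<Rightarrow> nat \<Rightarrow> int" where
  "weight n j = int n - 2 * int j"

text \<open>The tensor \<open>v\<^sub>i \<otimes> w\<^sub>j\<close> has the index \<open>i * dim W + j\<close>.\<close>

definition kron :: "'a::semiring_1 mat \<Rightarrow> 'a mat \<Rightarrow> 'a mat" where
  "kron A B = mat (dim_row A * dim_row B) (dim_col A * dim_col B) (\<lambda>(i, j).
     A $$ (i div dim_row B, j div dim_col B) * B $$ (i mod dim_row B, j mod dim_col B))"

definition qHH_mat :: "'a::field \<Rightarrow> nat \<Rightarrow> 'a mat" where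
  "qHH_mat s n = mat ((n + 1) * (n + 1)) ((n + 1) * (n + 1)) (\<lambda>(i, j).
     if i = j then s powi (weight n (i div (n + 1)) * weight n (i mod (n + 1))) else 0)"

text \<open>The sum in the R-matrix stops at \<open>n\<close> because \<open>E\<^sup>m = 0\<close> for \<open>m > n\<close>.\<close>

definition R_mat :: "'a::field \<Rightarrow> nat \<Rightarrow> 'a mat" where
  "R_mat s n = qHH_mat s n * mat ((n + 1) * (n + 1)) ((n + 1) * (n + 1)) (\<lambda>ij.
     \<Sum>m\<le>n. (s powi 2 - s powi (- 2)) ^ m * s powi (int m * (int m - 1)) / qnum_fact s m
            * kron (E_mat n ^\<^sub>m m) (F_mat s n ^\<^sub>m m) $$ ij)"

definition flip_mat :: "nat \<Rightarrow> 'a::semiring_1 mat" where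
  "flip_mat d = mat (d * d) (d * d) (\<lambda>(i, j). of_bool (i div d = j mod d \<and> i mod d = j div d))"

definition braiding :: "'a::field \<Rightarrow> nat \<Rightarrow> 'a mat" where
  "braiding s n = flip_mat (n + 1) * R_mat s n"

definition braiding_inv :: "'a::field \<Rightarrow> nat \<Rightarrow> 'a mat" where
  "braiding_inv s n = (THE B. B \<in> carrier_mat ((n + 1) * (n + 1)) ((n + 1) * (n + 1)) \<and>
     inverts_mat (braiding s n) B \<and> inverts_mat B (braiding s n))"

text \<open>
  With respect to the dual basis \<open>v\<^sup>j\<close> and the pivotal element \<open>K\<close>, the maps for caps and cups are
  \<open>x \<otimes> f \<mapsto> f (K x)\<close>, \<open>f \<otimes> x \<mapsto> f x\<close>, \<open>1 \<mapsto> \<Sum> v\<^sup>j \<otimes> K\<^sup>-\<^sup>1 v\<^sub>j\<close> and \<open>1 \<mapsto> \<Sum> v\<^sub>j \<otimes> v\<^sup>j\<close>.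
\<close>

fun elem_mat :: "'a::field \<Rightarrow> nat \<Rightarrow> elem \<Rightarrow> 'a mat" where
  "elem_mat s n Pos = braiding s n"
| "elem_mat s n Neg = braiding_inv s n"
| "elem_mat s n CapLR = mat 1 ((n + 1) * (n + 1)) (\<lambda>(_, i).
     if i div (n + 1) = i mod (n + 1) then s powi (2 * weight n (i mod (n + 1))) else 0)"
| "elem_mat s n CapRL = mat 1 ((n + 1) * (n + 1)) (\<lambda>(_, i).
     if i div (n + 1) = i mod (n + 1) then 1 else 0)"
| "elem_mat s n CupLR = mat ((n + 1) * (n + 1)) 1 (\<lambda>(i, _).
     if i div (n + 1) = i mod (n + 1) then s powi (- 2 * weight n (i mod (n + 1))) else 0)"
| "elem_mat s n CupRL = mat ((n + 1) * (n + 1)) 1 (\<lambda>(i, _).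
     if i div (n + 1) = i mod (n + 1) then 1 else 0)"

fun RT_mat :: "'a::field \<Rightarrow> nat \<Rightarrow> diagram \<Rightarrow> 'a mat" where
  "RT_mat s n [] = 1\<^sub>m (n + 1)"
| "RT_mat s n ((u, e, v) # D) = RT_mat s n D *
     kron (1\<^sub>m ((n + 1) ^ length u)) (kron (elem_mat s n e) (1\<^sub>m ((n + 1) ^ length v)))"

text \<open>
  \<open>colored_jones D n J\<close> means that \<open>J\<close> is the value at \<open>q = e\<^sup>h\<close> of the colored Jones polynomial
  $J_n(q^2)$.  The operator is taken over the field \<open>\<rat>((h))\<close>, with \<open>s = e\<^sup>h\<^sup>/\<^sup>2\<close>.
\<close>

definition colored_jones :: "diagram \<Rightarrow> nat \<Rightarrow> rat fps \<Rightarrow> bool" where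
  "colored_jones D n J \<longleftrightarrow>
     RT_mat (fps_to_fls (fps_exp (1 / 2))) n D = fps_to_fls J \<cdot>\<^sub>m 1\<^sub>m (n + 1)"


section \<open>The loop expansion\<close>

text \<open>
  \<open>loop_series \<iota> c A P\<close> is $\sum_k P_k(e^{2ch}) A(e^{2ch})^{-2k-1} h^k$.  The reciprocal is the
  power series inverse of a series whose constant term is the power of \<open>A(1) = 1\<close>; the coefficient
  ring \<open>\<rat>[\<alpha>]\<close> is not a field, and \<^term>\<open>fps_left_inverse\<close> does not require it.
\<close>

definition loop_series ::
  "(rat \<Rightarrow> 'a) \<Rightarrow> 'a \<Rightarrow> int laurent \<Rightarrow> (nat \<Rightarrow> rat laurent) \<Rightarrow> 'a::comm_ring_1 fps" where
  "loop_series \<iota> c A P =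
     suminf (\<lambda>k. laurent_exp \<iota> (2 * c) (P k)
          * fps_left_inverse (laurent_exp \<iota> (2 * c) (Poly_Mapping.map of_int A) ^ (2 * k + 1)) 1
          * fps_X ^ k)"

text \<open>The property which characterizes Rozansky's Laurent polynomials \<open>P\<^sub>k\<close>.\<close>

definition loop_polynomials :: "diagram \<Rightarrow> (nat \<Rightarrow> rat laurent) \<Rightarrow> bool" where
  "loop_polynomials D P \<longleftrightarrow>
     (\<forall>n. colored_jones D n (loop_series id (of_nat n) (alexander D) P))"

definition J_alpha :: "diagram \<Rightarrow> (nat \<Rightarrow> rat laurent) \<Rightarrow> rat poly fps" where
  "J_alpha D P = loop_series (\<lambda>r. [:r:]) [:0, 1:] (alexander D) P"


section \<open>The unified invariant\<close>

text \<open>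
  The ring \<open>R = \<int>[q\<^sup>\<plusminus>\<^sup>1, A\<^sup>\<plusminus>\<^sup>1]\<close> is represented as Laurent polynomials in \<open>A\<close> whose coefficients are
  Laurent polynomials in \<open>q\<close>.  Here \<open>mon x y\<close> is \<open>q\<^sup>x A\<^sup>y\<close>.
\<close>

type_synonym qA_ring = "int laurent laurent"

definition mon :: "int \<Rightarrow> int \<Rightarrow> qA_ring" where
  "mon x y = Poly_Mapping.single y (Poly_Mapping.single x 1)"

definition lquot :: "int laurent \<Rightarrow> int laurent \<Rightarrow> int laurent" where
  "lquot f g = (THE c. c * g = f)"

definition qbrace :: "nat \<Rightarrow> int laurent" where
  "qbrace n = Poly_Mapping.single (int n) 1 - Poly_Mapping.single (- int n) 1"

definition qfact :: "nat \<Rightarrow> int laurent" where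
  "qfact n = (\<Prod>i = 1..n. lquot (qbrace i) (qbrace 1))"

definition qbinom :: "nat \<Rightarrow> nat \<Rightarrow> int laurent" where
  "qbinom n k = lquot (qfact n) (qfact (n - k) * qfact k)"

text \<open>\<open>abrace k n\<close> is $\{\alpha+k;n\}_q$.\<close>

definition abrace :: "int \<Rightarrow> nat \<Rightarrow> qA_ring" where
  "abrace k n = (\<Prod>i<n. mon (k - int i) 1 - mon (int i - k) (- 1))"

definition I_ideal :: "nat \<Rightarrow> qA_ring set" where
  "I_ideal n = {\<Sum>l\<in>L. r l * abrace l n | (r :: int \<Rightarrow> qA_ring) L. finite L}"

definition coset :: "nat \<Rightarrow> qA_ring \<Rightarrow> qA_ring set" where
  "coset n x = {y. y - x \<in> I_ideal n}"

text \<open>The inverse limit of the rings \<open>R / I\<^sub>n\<close>, as compatible sequences of cosets.\<close>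

definition R_hat :: "(nat \<Rightarrow> qA_ring set) set" where
  "R_hat = {X. (\<forall>n. \<exists>x. X n = coset n x) \<and> (\<forall>n. X (Suc n) \<subseteq> X n)}"

text \<open>The substitution \<open>q = e\<^sup>h\<close>, \<open>A = e\<^sup>\<alpha>\<^sup>h\<close> on \<open>R\<close>.\<close>

definition R_to_fps :: "qA_ring \<Rightarrow> rat poly fps" where
  "R_to_fps f = (\<Sum>y \<in> Poly_Mapping.keys f. \<Sum>x \<in> Poly_Mapping.keys (Poly_Mapping.lookup f y).
     of_int (Poly_Mapping.lookup (Poly_Mapping.lookup f y) x)
       * exp_h (\<lambda>r. [:r:]) [:of_int x, of_int y:])"

text \<open>
  It maps \<open>I\<^sub>n\<close> into the ideal generated by \<open>h\<^sup>n\<close>.  The induced map on the inverse limit sends \<open>X\<close> to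
  the series which agrees below degree \<open>n\<close> with the images of the representatives of \<open>X n\<close>.
\<close>

definition R_hat_to_fps :: "(nat \<Rightarrow> qA_ring set) \<Rightarrow> rat poly fps" where
  "R_hat_to_fps X = (THE f. \<forall>n. \<forall>x \<in> X n. \<forall>m < n. fps_nth f m = fps_nth (R_to_fps x) m)"

text \<open>The label carried by the strand at time \<open>m\<close>, for the multi-index \<open>i\<close>.\<close>

definition label :: "diagram \<Rightarrow> nat list \<Rightarrow> nat \<Rightarrow> int" where
  "label D i m = (\<Sum>k < length (crossings D). int (i ! k) *
     (of_bool (under_time D (crossings D ! k) < m) - of_bool (over_time D (crossings D ! k) < m)))"

definition turn_factor :: "diagram \<Rightarrow> nat list \<Rightarrow> nat \<Rightarrow> qA_ring" where
  "turn_factor D i l =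
     (case elem_at D l of
        CapLR \<Rightarrow> mon (- 2 * label D i (time D (l, left_width D l, Up))) 1
      | CupLR \<Rightarrow> mon (2 * label D i (time D (Suc l, left_width D l, Down))) (- 1)
      | _ \<Rightarrow> 1)"

definition crossing_factor :: "diagram \<Rightarrow> nat list \<Rightarrow> nat \<Rightarrow> qA_ring" where
  "crossing_factor D i k =
     (let l = crossings D ! k;
          m = i ! k;
          a = label D i (under_time D l);
          b = label D i (over_time D l);
          common = Poly_Mapping.single 0 (qbinom (nat a + m) m) * abrace (- a) m
      in if elem_at D l = Pos
         then mon (int m * (int m - 1) div 2) 0 * common * mon 0 (- (a + b))
                * mon (2 * (a + int m) * (b - int m)) 0
         else (- 1) ^ m * mon (- (int m * (int m - 1) div 2)) 0 * common * mon 0 (a + b)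
                * mon (- 2 * a * b) 0)"

definition state_term :: "diagram \<Rightarrow> nat list \<Rightarrow> qA_ring" where
  "state_term D i =
     (if \<exists>m \<le> strand_length D. label D i m < 0 then 0
      else (\<Prod>l < length D. turn_factor D i l) * (\<Prod>k < length (crossings D). crossing_factor D i k))"

text \<open>
  Only finitely many multi-indices contribute modulo \<open>I\<^sub>n\<close>: if \<open>i\<^sub>k \<ge> n\<close> for some \<open>k\<close>, then
  $\{\alpha-a_k;i_k\}_q$, and hence the term, lies in \<open>I\<^sub>n\<close>.
\<close>

definition F_infty :: "diagram \<Rightarrow> nat \<Rightarrow> qA_ring set" where
  "F_infty D n = coset n
     (\<Sum>i | length i = length (crossings D) \<and> state_term D i \<notin> I_ideal n. state_term D i)"

lemma I_ideal_mult: "r * abrace l n \<in> I_ideal n"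
  unfolding I_ideal_def by (rule CollectI, rule exI[of _ "\<lambda>_. r"], rule exI[of _ "{l}"]) simp

lemma I_ideal_add:
  assumes "x \<in> I_ideal n" "y \<in> I_ideal n"
  shows "x + y \<in> I_ideal n"
proof -
  obtain r L where x: "x = (\<Sum>l\<in>L. r l * abrace l n)" "finite L"
    using assms(1) by (auto simp: I_ideal_def)
  obtain r' L' where y: "y = (\<Sum>l\<in>L'. r' l * abrace l n)" "finite L'"
    using assms(2) by (auto simp: I_ideal_def)
  have "x = (\<Sum>l\<in>L \<union> L'. (if l \<in> L then r l else 0) * abrace l n)"
    unfolding x(1) by (rule sum.mono_neutral_cong_left) (use x y in auto)
  moreover have "y = (\<Sum>l\<in>L \<union> L'. (if l \<in> L' then r' l else 0) * abrace l n)"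
    unfolding y(1) by (rule sum.mono_neutral_cong_left) (use x y in auto)
  ultimately have "x + y = (\<Sum>l\<in>L \<union> L'.
      ((if l \<in> L then r l else 0) + (if l \<in> L' then r' l else 0)) * abrace l n)"
    by (simp only: distrib_right sum.distrib)
  then show ?thesis
    unfolding I_ideal_def using x(2) y(2)
    by (intro CollectI exI[of _ "\<lambda>l. (if l \<in> L then r l else 0) + (if l \<in> L' then r' l else 0)"]
        exI[of _ "L \<union> L'"]) simp
qed

lemma I_ideal_0: "0 \<in> I_ideal n"
  using I_ideal_mult[of 0] by simp

lemma I_ideal_sum: "(\<And>x. x \<in> S \<Longrightarrow> f x \<in> I_ideal n) \<Longrightarrow> sum f S \<in> I_ideal n"
  by (induction S rule: infinite_finite_induct) (auto intro: I_ideal_add I_ideal_0)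

lemma I_ideal_Suc: "I_ideal (Suc n) \<subseteq> I_ideal n"
proof
  fix x assume "x \<in> I_ideal (Suc n)"
  then obtain r L where x: "x = (\<Sum>l\<in>L. r l * abrace l (Suc n))"
    by (auto simp: I_ideal_def)
  have "r l * abrace l (Suc n) \<in> I_ideal n" for l
  proof -
    have "r l * abrace l (Suc n) =
        (r l * (mon (l - int n) 1 - mon (int n - l) (- 1))) * abrace l n"
      by (simp add: abrace_def mult_ac)
    then show ?thesis by (simp only: I_ideal_mult)
  qed
  then show "x \<in> I_ideal n" unfolding x by (intro I_ideal_sum)
qed

lemma abrace_dvd: "n \<le> m \<Longrightarrow> abrace k n dvd abrace k m"
  unfolding abrace_def by (rule prod_dvd_prod_subset) auto

lemma state_term_in_I_ideal:
  assumes "k < length (crossings D)" "n \<le> i ! k"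
  shows "state_term D i \<in> I_ideal n"
proof (cases "\<exists>m \<le> strand_length D. label D i m < 0")
  case True
  then show ?thesis by (simp add: state_term_def I_ideal_0)
next
  case False
  let ?a = "label D i (under_time D (crossings D ! k))"
  have "abrace (- ?a) n dvd abrace (- ?a) (i ! k)" using assms(2) by (rule abrace_dvd)
  also have "\<dots> dvd crossing_factor D i k"
    by (auto simp: crossing_factor_def Let_def intro!: dvd_mult dvd_mult2)
  also have "\<dots> dvd (\<Prod>k < length (crossings D). crossing_factor D i k)"
    by (rule dvd_prodI) (use assms(1) in auto)
  also have "\<dots> dvd state_term D i" using False by (simp add: state_term_def)
  finally obtain c where "state_term D i = abrace (- ?a) n * c" by (rule dvdE)
  then show ?thesis by (simp add: I_ideal_mult mult.commute)
qed

lemma finite_state_terms: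
  "finite {i. length i = length (crossings D) \<and> state_term D i \<notin> I_ideal n}"
proof (rule finite_subset)
  show "{i. length i = length (crossings D) \<and> state_term D i \<notin> I_ideal n}
      \<subseteq> {i. set i \<subseteq> {..<n} \<and> length i = length (crossings D)}"
  proof clarsimp
    fix i x
    assume i: "length i = length (crossings D)" "state_term D i \<notin> I_ideal n" and "x \<in> set i"
    then obtain k where "k < length (crossings D)" "x = i ! k" by (metis in_set_conv_nth)
    then show "x < n" using state_term_in_I_ideal[of k D n i] i(2) by (meson not_le)
  qed
qed (rule finite_lists_length_eq, simp)

lemma F_infty_in_R_hat: "F_infty D \<in> R_hat"
  unfolding R_hat_def
proof (intro CollectI conjI allI)
  fix n
  let ?S = "\<lambda>n. {i. length i = length (crossings D) \<and> state_term D i \<notin> I_ideal n}"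
  show "\<exists>x. F_infty D n = coset n x" by (auto simp: F_infty_def)
  have "sum (state_term D) (?S (Suc n)) =
      sum (state_term D) (?S (Suc n) - ?S n) + sum (state_term D) (?S n)"
    by (rule sum.subset_diff) (use I_ideal_Suc finite_state_terms in auto)
  moreover have "sum (state_term D) (?S (Suc n) - ?S n) \<in> I_ideal n"
    by (rule I_ideal_sum) auto
  ultimately have d: "sum (state_term D) (?S (Suc n)) - sum (state_term D) (?S n) \<in> I_ideal n"
    by simp
  show "F_infty D (Suc n) \<subseteq> F_infty D n"
  proof
    fix y assume "y \<in> F_infty D (Suc n)"
    then have "y - sum (state_term D) (?S (Suc n)) \<in> I_ideal n"
      using I_ideal_Suc by (auto simp: F_infty_def coset_def)
    from I_ideal_add[OF this d] show "y \<in> F_infty D n"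
      by (simp add: F_infty_def coset_def)
  qed
qed

end

theory Submission
  imports Defs
begin

text \<open>
  The coefficients of both power series are polynomials in $\alpha$, so it suffices to compare
  them at all natural numbers $\alpha = n$.  There the left-hand side becomes $J_n(q^2)$, the entry
  of the Reshetikhin--Turaev operator at the highest weight vector.  Expanded in the weight basis,
  this entry is a sum over labelings of the diagram by $0, \dots, n$ that satisfy a local condition
  at every layer.  As the open strand visits every position exactly once and its label changes only at
  crossings, such a labeling amounts to a multi-index $(i_1, \dots, i_N)$ all of whose labels lie
  between $0$ and $n$, and the product of the matrix entries is $D(i_1, \dots, i_N)$ at $A = q^n$, up
  to the framing factor $q^{n^2 w / 2}$, where the writhe $w$ vanishes.  All other multi-indices
  contribute $0$ at $A = q^n$.
\<close>

text \<open>The two sides are finite for different reasons. At \<open>A = q^c\<close> the operator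
  sees only labels \<open>0, ..., c\<close>, to all orders in \<open>h\<close>. The invariant is a
  limit over the ideals \<open>I_n\<close>, modulo which finitely many multi-indices survive,
  uniformly in \<open>c\<close>. The link is that \<open>{\<alpha>+l;n}\<close> is a product of
  \<open>n\<close> differences of exponentials, so that \<open>I_n\<close> lands in the multiples of
  \<open>h^n\<close>. Each coefficient at each \<open>c\<close> thus compares two finite sums whose
  surplus terms vanish: on one side below degree \<open>n\<close>, on the other at
  \<open>A = q^c\<close>.

  The shape of the summand comes from the basis with \<open>E v_j = v_(j-1)\<close>: all quantum
  integers sit in \<open>F\<close>, so \<open>F^i v_a\<close> carries
  \<open>[a+1]...[a+i] [n-a]...[n-a-i+1]\<close>, and division by \<open>[i]!\<close> leaves the
  binomial and the brace.

  The matrices need division and \<open>q^(1/2)\<close>, hence the field of Laurent series with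
  \<open>s = e^(h/2)\<close>. The ring \<open>R\<close> specializes to power series, and the two
  sides meet through the injection of power series into Laurent series.\<close>

definition laurent_eval :: "('b \<Rightarrow> 'a) \<Rightarrow> 'a \<Rightarrow> 'b::zero laurent \<Rightarrow> 'a::field" where
  "laurent_eval g x f =
     (\<Sum>k \<in> Poly_Mapping.keys f. g (Poly_Mapping.lookup f k) * x powi k)"

context
  fixes g :: "'b::comm_ring_1 \<Rightarrow> 'a::field" and x :: 'a
  assumes g: "comm_ring_hom g" and x: "x \<noteq> 0"
begin

interpretation g: comm_ring_hom g by (rule g)

text \<open>Cancellation can make the support of a sum smaller than those of its summands; over a
  common finite superset additivity holds term by term.\<close>

lemma laurent_eval_superset:
  assumes "finite S" "Poly_Mapping.keys f \<subseteq> S"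
  shows "laurent_eval g x f = (\<Sum>k\<in>S. g (Poly_Mapping.lookup f k) * x powi k)"
  unfolding laurent_eval_def
  by (rule sum.mono_neutral_left) (use assms in \<open>auto simp: in_keys_iff\<close>)

lemma laurent_eval_single: "laurent_eval g x (Poly_Mapping.single k b) = g b * x powi k"
  by (simp add: laurent_eval_superset[of "{k}"])

lemma laurent_eval_add: "laurent_eval g x (f + f') = laurent_eval g x f + laurent_eval g x f'"
proof -
  let ?S = "Poly_Mapping.keys f \<union> Poly_Mapping.keys f'"
  have "Poly_Mapping.keys (f + f') \<subseteq> ?S" by (rule Poly_Mapping.keys_add)
  then show ?thesis
    by (simp add: laurent_eval_superset[of ?S] lookup_add g.hom_add distrib_right sum.distrib)
qed

lemma laurent_eval_sum: "laurent_eval g x (sum F S) = (\<Sum>i\<in>S. laurent_eval g x (F i))"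
  by (induction S rule: infinite_finite_induct)
     (simp_all add: laurent_eval_add, simp_all add: laurent_eval_def)

lemma laurent_eval_mult: "laurent_eval g x (f * f') = laurent_eval g x f * laurent_eval g x f'"
proof -
  have decomp: "p = (\<Sum>k\<in>Poly_Mapping.keys p. Poly_Mapping.single k (Poly_Mapping.lookup p k))"
    for p :: "'b laurent"
    by (rule poly_mapping_eqI)
       (simp add: lookup_sum lookup_single when_def in_keys_iff sum.delta)
  have "f * f' = (\<Sum>k\<in>Poly_Mapping.keys f. \<Sum>l\<in>Poly_Mapping.keys f'.
      Poly_Mapping.single (k + l) (Poly_Mapping.lookup f k * Poly_Mapping.lookup f' l))"
    by (subst decomp[of f], subst decomp[of f'])
       (simp add: sum_product mult_single)
  then have "laurent_eval g x (f * f') = (\<Sum>k\<in>Poly_Mapping.keys f. \<Sum>l\<in>Poly_Mapping.keys f'.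
      (g (Poly_Mapping.lookup f k) * x powi k) * (g (Poly_Mapping.lookup f' l) * x powi l))"
    by (simp add: laurent_eval_sum laurent_eval_single g.hom_mult power_int_add x mult_ac)
  then show ?thesis by (simp add: laurent_eval_def sum_product)
qed

lemma laurent_eval_hom: "comm_ring_hom (laurent_eval g x)"
proof
  show "laurent_eval g x 1 = 1"
    using laurent_eval_single[of 0 1] by simp
  show "laurent_eval g x 0 = 0" by (simp add: laurent_eval_def)
qed (rule laurent_eval_add laurent_eval_mult)+

end

text \<open>Coefficients of powers of \<open>A\<close> are Laurent polynomials in \<open>q\<close>,
  so one evaluation is the coefficient map of the other. This is why \<open>laurent_eval\<close>
  takes the coefficient map as a parameter.\<close>

definition qA_eval :: "'a::field \<Rightarrow> 'a \<Rightarrow> qA_ring \<Rightarrow> 'a" where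
  "qA_eval q A = laurent_eval (laurent_eval of_int q) A"

lemma comm_ring_hom_of_int: "comm_ring_hom (of_int :: int \<Rightarrow> 'a::comm_ring_1)"
  by standard simp_all

lemma qA_eval_hom: "q \<noteq> 0 \<Longrightarrow> A \<noteq> 0 \<Longrightarrow> comm_ring_hom (qA_eval q A)"
  unfolding qA_eval_def by (intro laurent_eval_hom comm_ring_hom_of_int)

lemma qA_eval_single:
  assumes "q \<noteq> 0" "A \<noteq> 0"
  shows "qA_eval q A (Poly_Mapping.single y f) = laurent_eval of_int q f * A powi y"
  unfolding qA_eval_def by (intro laurent_eval_single laurent_eval_hom comm_ring_hom_of_int assms)

lemma qA_eval_mon: "q \<noteq> 0 \<Longrightarrow> A \<noteq> 0 \<Longrightarrow> qA_eval q A (mon x y) = q powi x * A powi y"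
  by (simp add: mon_def qA_eval_single laurent_eval_single comm_ring_hom_of_int)


section \<open>Specialization of $\alpha$\<close>

definition fps_eval :: "nat \<Rightarrow> rat poly fps \<Rightarrow> rat fps" where
  "fps_eval c F = Abs_fps (\<lambda>m. poly (fps_nth F m) (of_nat c))"

lemma fps_eval_nth [simp]: "fps_nth (fps_eval c F) m = poly (fps_nth F m) (of_nat c)"
  by (simp add: fps_eval_def)

lemma fps_eval_hom: "comm_ring_hom (fps_eval c)"
  by standard (auto simp: fps_eq_iff fps_mult_nth poly_sum poly_0 poly_1)

interpretation fps_eval: comm_ring_hom "fps_eval c" for c by (rule fps_eval_hom)

text \<open>A nonzero polynomial has finitely many roots, whereas the naturals are infinite in the
  rationals.\<close>

lemma poly_eqI_of_nat:
  assumes "\<And>c. poly p (of_nat c) = poly (p' :: rat poly) (of_nat c)"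
  shows "p = p'"
proof (rule ccontr)
  assume "p \<noteq> p'"
  then have "finite {x. poly (p - p') x = 0}" by (intro poly_roots_finite) simp
  then have "finite (of_nat ` (UNIV :: nat set) :: rat set)"
    by (rule finite_subset[rotated]) (auto simp: assms)
  then show False by (simp add: finite_image_iff inj_on_def)
qed

lemma fps_eval_exp_h:
  "fps_eval c (exp_h (\<lambda>r. [:r:]) p) = fps_exp (poly p (of_nat c))"
  by (simp add: fps_eq_iff exp_h_def fps_exp_def divide_simps)

lemma exp_h_id: "exp_h id (c :: rat) = fps_exp c"
  by (simp add: fps_eq_iff exp_h_def)

section \<open>Exponentials in the field of Laurent series\<close>

definition fls_exp :: "rat \<Rightarrow> rat fls" where
  "fls_exp c = fps_to_fls (fps_exp c)"

lemma fls_exp_add: "fls_exp (a + b) = fls_exp a * fls_exp b"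
  by (simp add: fls_exp_def fls_times_fps_to_fls fps_exp_add_mult)

lemma fls_exp_0 [simp]: "fls_exp 0 = 1"
  by (simp add: fls_exp_def)

lemma fls_exp_nonzero [simp]: "fls_exp c \<noteq> 0"
  using fls_exp_add[of c "- c"] by auto

lemma fls_exp_power: "fls_exp c ^ n = fls_exp (of_nat n * c)"
  by (induction n) (simp_all add: fls_exp_add[symmetric] algebra_simps)

lemma fls_exp_minus: "fls_exp (- c) = inverse (fls_exp c)"
  using fls_exp_add[of c "- c"] by (metis fls_exp_0 add.right_inverse inverse_unique)

lemma fls_exp_powi: "fls_exp c powi n = fls_exp (of_int n * c)"
proof (cases "n \<ge> 0")
  case True
  then show ?thesis by (simp add: power_int_def fls_exp_power)
next
  case False
  then have "of_nat (nat (- n)) = (- of_int n :: rat)" by simp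
  then show ?thesis using False
    by (simp add: power_int_def fls_exp_power fls_exp_minus[symmetric] power_inverse[symmetric])
qed

lemma fps_exp_inj: "fps_exp a = fps_exp (b :: rat) \<Longrightarrow> a = b"
  by (drule arg_cong[of _ _ "\<lambda>f. fps_nth f 1"]) simp

lemma fls_exp_eq_iff [simp]: "fls_exp a = fls_exp b \<longleftrightarrow> a = b"
  by (auto simp: fls_exp_def dest: fps_exp_inj)

section \<open>Specialization of the ring \<open>R\<close> at \<open>q = e^h\<close>,
  \<open>A = e^(ch)\<close>\<close>

definition spec :: "nat \<Rightarrow> qA_ring \<Rightarrow> rat fps" where
  "spec c f = fps_eval c (R_to_fps f)"

lemma fps_to_fls_sum: "fps_to_fls (sum f S) = (\<Sum>i\<in>S. fps_to_fls (f i :: rat fps))"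
  by (induction S rule: infinite_finite_induct) simp_all

lemma spec_eq_qA_eval: "fps_to_fls (spec c f) = qA_eval (fls_exp 1) (fls_exp (of_nat c)) f"
proof -
  have "spec c f = (\<Sum>y \<in> Poly_Mapping.keys f. \<Sum>x \<in> Poly_Mapping.keys (Poly_Mapping.lookup f y).
     of_int (Poly_Mapping.lookup (Poly_Mapping.lookup f y) x)
       * fps_exp (of_int x + of_int y * of_nat c))"
    by (simp add: spec_def R_to_fps_def fps_eval.hom_sum fps_eval.hom_mult fps_eval_exp_h
          fps_eval.hom_of_int mult_ac)
  also have "fps_to_fls \<dots> = qA_eval (fls_exp 1) (fls_exp (of_nat c)) f"
    by (simp add: qA_eval_def laurent_eval_def fps_to_fls_sum fls_times_fps_to_fls
        fls_exp_def[symmetric] fls_exp_powi fls_exp_add sum_distrib_right mult.assoc)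
  finally show ?thesis .
qed

text \<open>\<open>R_to_fps\<close> is a sum over supports, for which multiplicativity is not
  immediate. It is pulled back from \<open>qA_eval\<close> along the injection
  \<open>fps_to_fls\<close>.\<close>

lemma spec_hom: "comm_ring_hom (spec c)"
proof -
  interpret E: comm_ring_hom "qA_eval (fls_exp 1) (fls_exp (of_nat c))"
    by (rule qA_eval_hom) simp_all
  show ?thesis
  proof
    fix f g
    have "fps_to_fls (spec c (f + g)) = fps_to_fls (spec c f + spec c g)"
      by (simp add: spec_eq_qA_eval E.hom_add)
    then show "spec c (f + g) = spec c f + spec c g" by (simp only: fps_to_fls_eq_iff)
    have "fps_to_fls (spec c (f * g)) = fps_to_fls (spec c f * spec c g)"
      by (simp add: spec_eq_qA_eval E.hom_mult fls_times_fps_to_fls)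
    then show "spec c (f * g) = spec c f * spec c g" by (simp only: fps_to_fls_eq_iff)
  next
    have "fps_to_fls (spec c 1) = fps_to_fls 1" by (simp only: spec_eq_qA_eval E.hom_one fps_one_to_fls)
    then show "spec c 1 = 1" by (simp only: fps_to_fls_eq_iff)
    have "fps_to_fls (spec c 0) = fps_to_fls 0" by (simp only: spec_eq_qA_eval E.hom_zero fps_zero_to_fls)
    then show "spec c 0 = 0" by (simp only: fps_to_fls_eq_iff)
  qed
qed

interpretation spec: comm_ring_hom "spec c" for c by (rule spec_hom)

lemma spec_mon: "spec c (mon x y) = fps_exp (of_int x + of_int y * of_nat c)"
proof -
  have "fps_to_fls (spec c (mon x y)) = fls_exp (of_int x + of_int y * of_nat c)"
    by (simp add: spec_eq_qA_eval qA_eval_mon fls_exp_powi fls_exp_add)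
  then show ?thesis by (simp add: fls_exp_def)
qed

text \<open>Each of the \<open>n\<close> factors is a difference of two exponentials and has
  constant term \<open>0\<close>.\<close>

lemma fps_X_power_dvd_spec_abrace: "fps_X ^ n dvd spec c (abrace k n)"
proof -
  have "fps_X dvd fps_exp a - fps_exp b" for a b :: rat
    by (cases "fps_exp a - fps_exp b = 0")
       (auto simp: fps_dvd_iff Suc_le_eq subdegree_eq_0_iff intro!: Nat.gr0I)
  then have "(\<Prod>i<n. fps_X) dvd (\<Prod>i<n. spec c (mon (k - int i) 1 - mon (int i - k) (- 1)))"
    by (intro prod_dvd_prod) (simp add: spec.hom_minus spec_mon)
  then show ?thesis by (simp add: abrace_def spec.hom_prod)
qed

lemma fps_nth_spec_I_ideal:
  assumes "x \<in> I_ideal n" "m < n"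
  shows "fps_nth (spec c x) m = 0"
proof -
  obtain r L where x: "x = (\<Sum>l\<in>L. r l * abrace l n)"
    using assms(1) by (auto simp: I_ideal_def)
  have "fps_X ^ n dvd spec c x"
    unfolding x spec.hom_sum spec.hom_mult
    by (intro dvd_sum dvd_mult fps_X_power_dvd_spec_abrace)
  then obtain y where "spec c x = fps_X ^ n * y" by (rule dvdE)
  then show ?thesis using assms(2) by (simp add: fps_X_power_mult_nth)
qed

lemma spec_coset:
  assumes "x \<in> coset n y" "m < n"
  shows "fps_nth (spec c x) m = fps_nth (spec c y) m"
proof -
  have "fps_nth (spec c (x - y)) m = 0"
    using assms by (intro fps_nth_spec_I_ideal) (auto simp: coset_def)
  then show ?thesis by (simp add: spec.hom_minus)
qed

text \<open>Resolves the definite description. Existence needs only the values at natural numbers,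
  by \<open>poly_eqI_of_nat\<close>; uniqueness holds because any representative of the nonempty
  coset \<open>X (Suc m)\<close> fixes the coefficient of degree \<open>m\<close>.\<close>

lemma R_hat_to_fps_eqI:
  assumes "X \<in> R_hat"
    and "\<And>c n x m. x \<in> X n \<Longrightarrow> m < n \<Longrightarrow> fps_nth (fps_eval c f) m = fps_nth (spec c x) m"
  shows "R_hat_to_fps X = f"
  unfolding R_hat_to_fps_def
proof (rule the_equality)
  show *: "\<forall>n. \<forall>x\<in>X n. \<forall>m<n. fps_nth f m = fps_nth (R_to_fps x) m"
    using assms(2) by (intro allI ballI impI poly_eqI_of_nat) (simp add: spec_def)
  fix f' assume f': "\<forall>n. \<forall>x\<in>X n. \<forall>m<n. fps_nth f' m = fps_nth (R_to_fps x) m"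
  show "f' = f"
  proof (rule fps_ext)
    fix m
    obtain y where "X (Suc m) = coset (Suc m) y" using assms(1) unfolding R_hat_def by blast
    then have "y \<in> X (Suc m)" by (simp add: coset_def I_ideal_0)
    then show "fps_nth f' m = fps_nth f m" using * f' by (metis lessI)
  qed
qed


section \<open>The loop expansion at natural numbers\<close>

lemma fps_sums_mult_X_power:
  fixes f :: "nat \<Rightarrow> 'a::comm_ring_1 fps"
  shows "(\<lambda>k. f k * fps_X ^ k) sums Abs_fps (\<lambda>m. \<Sum>k\<le>m. fps_nth (f k * fps_X ^ k) m)"
  unfolding sums_def
proof (rule tendsto_fpsI)
  fix m
  show "\<forall>\<^sub>F n in sequentially. fps_nth (\<Sum>k<n. f k * fps_X ^ k) m =
      fps_nth (Abs_fps (\<lambda>m. \<Sum>k\<le>m. fps_nth (f k * fps_X ^ k) m)) m"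
    using eventually_gt_at_top[of m]
  proof eventually_elim
    case (elim n)
    have "(\<Sum>k\<le>m. fps_nth (f k * fps_X ^ k) m) = (\<Sum>k<n. fps_nth (f k * fps_X ^ k) m)"
      by (rule sum.mono_neutral_left) (use elim in \<open>auto simp: fps_X_power_mult_right_nth\<close>)
    then show ?case by (simp add: fps_sum_nth)
  qed
qed

text \<open>The \<open>k\<close>-th term is divisible by \<open>h^k\<close>, so the coefficient of
  degree \<open>m\<close> is a finite sum over \<open>k \<le> m\<close>, and evaluation commutes
  with finite sums. No continuity of the evaluation is invoked.\<close>

lemma fps_eval_suminf:
  "fps_eval c (suminf (\<lambda>k. f k * fps_X ^ k)) = suminf (\<lambda>k. fps_eval c (f k) * fps_X ^ k)"
proof -
  have "fps_eval c (f k * fps_X ^ k) = fps_eval c (f k) * fps_X ^ k" for k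
    by (auto simp: fps_eq_iff fps_X_power_mult_right_nth)
  then have "poly (fps_nth (f k * fps_X ^ k) m) (of_nat c)
      = fps_nth (fps_eval c (f k) * fps_X ^ k) m" for k m
    by (metis fps_eval_nth)
  then show ?thesis
    unfolding sums_unique[OF fps_sums_mult_X_power, symmetric]
    by (simp add: fps_eq_iff poly_sum)
qed

text \<open>The coefficients of the inverse are given by a recursion that uses ring operations only,
  so evaluation passes through it by induction on the degree.\<close>

lemma fps_eval_left_inverse: "fps_eval c (fps_left_inverse F 1) = fps_left_inverse (fps_eval c F) 1"
proof (rule fps_ext)
  fix m
  show "fps_nth (fps_eval c (fps_left_inverse F 1)) m = fps_nth (fps_left_inverse (fps_eval c F) 1) m"
  proof (induction m rule: less_induct)
    case (less m)
    then show ?case by (cases m) (simp_all add: poly_sum)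
  qed
qed

lemma fps_eval_laurent_exp:
  "fps_eval c (laurent_exp (\<lambda>r. [:r:]) p f) = laurent_exp id (poly p (of_nat c)) f"
proof -
  have "fps_eval c (fps_const [:r:]) = fps_const r" for r
    by (simp add: fps_eq_iff)
  then show ?thesis
    by (simp add: laurent_exp_def fps_eval.hom_sum fps_eval.hom_mult fps_eval_exp_h exp_h_id)
qed

lemma fps_eval_J_alpha: "fps_eval c (J_alpha D P) = loop_series id (of_nat c) (alexander D) P"
  by (simp add: J_alpha_def loop_series_def fps_eval_suminf fps_eval.hom_mult fps_eval.hom_power
      fps_eval_left_inverse fps_eval_laurent_exp mult.commute[of "of_nat c" 2])

section \<open>Quantum integers\<close>

lemma digit_less: "a < d \<Longrightarrow> r < m \<Longrightarrow> a * m + r < d * (m :: nat)"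
proof -
  assume "a < d" "r < m"
  then have "a * m + r < Suc a * m" "Suc a * m \<le> d * m"
    by (simp, intro mult_le_mono1, simp)
  then show ?thesis by (rule less_le_trans)
qed

lemma pair_eq_iff:
  "b < d \<Longrightarrow> b' < d \<Longrightarrow> a * d + b = a' * d + b' \<longleftrightarrow> a = a' \<and> b = (b' :: nat)"
  by (metis add.commute div_mult_self3 div_less add_0 mod_mult_self3 mod_less less_nat_zero_code)

lemma sum_pair: "(\<Sum>i<d * d. f i) = (\<Sum>a<d. \<Sum>b<d. f (a * d + b :: nat))"
proof -
  have "sum f {a * d..<a * d + d} = (\<Sum>b<d. f (a * d + b))" for a
    by (rule sum.reindex_bij_witness[of _ "\<lambda>b. a * d + b" "\<lambda>i. i - a * d"]) auto
  then show ?thesis by (simp add: sum.nat_group[symmetric])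
qed

lemma mat_pair_entry:
  assumes "a < d" "b < d" "a' < d" "b' < d"
  shows "mat (d * d) (d * d) f $$ (a * d + b, a' * d + b') = f (a * d + b, a' * d + b')"
  using assms by (simp add: digit_less)

lemma kron_pair_entry:
  assumes "A \<in> carrier_mat d d" "B \<in> carrier_mat d d"
    and "a < d" "b < d" "a' < d" "b' < d"
  shows "kron A B $$ (a * d + b, a' * d + b') = A $$ (a, a') * B $$ (b, b')"
proof -
  have "kron A B = mat (d * d) (d * d)
      (\<lambda>(i, j). A $$ (i div d, j div d) * B $$ (i mod d, j mod d))"
    using assms by (simp add: kron_def)
  then show ?thesis using assms by (simp add: mat_pair_entry)
qed

lemma mult_mat_pair_entry:
  assumes "A \<in> carrier_mat (d * d) (d * d)" "B \<in> carrier_mat (d * d) (d * d)"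
    and "a < d" "b < d" "a' < d" "b' < d"
  shows "(A * B) $$ (a * d + b, a' * d + b') =
    (\<Sum>x<d. \<Sum>y<d. A $$ (a * d + b, x * d + y) * B $$ (x * d + y, a' * d + b'))"
  using assms digit_less[of a d b d] digit_less[of a' d b' d]
  unfolding sum_pair[of "\<lambda>i. A $$ (a * d + b, i) * B $$ (i, a' * d + b')", symmetric]
  by (simp add: scalar_prod_def lessThan_atLeast0)

text \<open>With \<open>q = s^2\<close> the condition reads \<open>q^k \<noteq> q^(-k)\<close>. It
  keeps the quantum integers \<open>[k]\<close>, \<open>k > 0\<close>, nonzero, by which the
  R-matrix divides.\<close>

locale generic_q =
  fixes s :: "'a::field"
  assumes s_nonzero [simp]: "s \<noteq> 0"
    and generic: "k > 0 \<Longrightarrow> s powi (2 * k) \<noteq> s powi (- 2 * k)"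
begin

lemma qnum_nonzero: "k > 0 \<Longrightarrow> qnum s k \<noteq> 0"
  using generic[of k] generic[of 1] by (simp add: qnum_def)

lemma qnum_0 [simp]: "qnum s 0 = 0"
  by (simp add: qnum_def)

lemma qnum_fact_nonzero: "qnum_fact s m \<noteq> 0"
  by (auto simp: qnum_fact_def qnum_nonzero)

lemma qnum_fact_Suc: "qnum_fact s (Suc m) = qnum_fact s m * qnum s (int m + 1)"
  by (simp add: qnum_fact_def add.commute)

lemma qnum_fact_0 [simp]: "qnum_fact s 0 = 1"
  by (simp add: qnum_fact_def)

lemma qnum_add:
  "qnum s (a + b) = s powi (- 2 * b) * qnum s a + s powi (2 * a) * qnum s b"
proof -
  have "s powi (2 * (a + b)) - s powi (- 2 * (a + b))
      = s powi (- 2 * b) * (s powi (2 * a) - s powi (- 2 * a))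
        + s powi (2 * a) * (s powi (2 * b) - s powi (- 2 * b))"
    by (simp add: right_diff_distrib power_int_add[symmetric] algebra_simps)
  then show ?thesis
    by (simp add: qnum_def add_divide_distrib)
qed

definition pos_coeff :: "nat \<Rightarrow> 'a" where
  "pos_coeff m = (s powi 2 - s powi (- 2)) ^ m * s powi (int m * (int m - 1)) / qnum_fact s m"

text \<open>This is \<open>pos_coeff\<close> with \<open>q\<close> replaced by
  \<open>q^(-1)\<close>: \<open>{1}\<close> changes its sign and \<open>[m]!\<close> is invariant.
  The two sequences are the coefficients of mutually inverse q-exponential series.\<close>

definition neg_coeff :: "nat \<Rightarrow> 'a" where
  "neg_coeff m =
     (- 1) ^ m * (s powi 2 - s powi (- 2)) ^ m * s powi (- (int m * (int m - 1))) / qnum_fact s m"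

lemma coeff_0 [simp]: "pos_coeff 0 = 1" "neg_coeff 0 = 1"
  by (simp_all add: pos_coeff_def neg_coeff_def)

text \<open>
  Multiplied by $[k] = q^{-j} [k-j] + q^{k-j} [j]$, each summand splits into two, and the sum
  telescopes.
\<close>

lemma coeff_convolution:
  assumes "k > 0"
  shows "(\<Sum>j\<le>k. pos_coeff (k - j) * neg_coeff j) = 0"
proof -
  let ?z = "s powi 2 - s powi (- 2)"
  define t where "t j = (- 1) ^ j * s powi (int (k - j) * (int (k - j) - 1) - int j * (int j - 1))
      / (qnum_fact s (k - j) * qnum_fact s j)" for j
  \<comment> \<open>The common value of \<open>u j\<close> and \<open>- v (Suc j)\<close> for
    \<open>j < k\<close>, the range in which the truncated \<open>k - j - 1\<close> is a true
    difference.\<close>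
  define w where "w j = (- 1) ^ j * s powi (int (k - j) * (int (k - j) - 1) - int j * (int j + 1))
      / (qnum_fact s (k - j - 1) * qnum_fact s j)" for j
  define u where "u j = s powi (- 2 * int j) * qnum s (int (k - j)) * t j" for j
  define v where "v j = s powi (2 * int (k - j)) * qnum s (int j) * t j" for j
  have split: "qnum s (int k) * t j = u j + v j" if "j \<le> k" for j
    using qnum_add[of "int (k - j)" "int j"] that by (simp add: u_def v_def algebra_simps of_nat_diff)
  have u: "u j = w j" if j: "j < k" for j
  proof -
    obtain i where i: "k - j = Suc i" using j by (metis Suc_diff_Suc)
    have "s powi (- 2 * int j) * s powi (int (Suc i) * (int (Suc i) - 1) - int j * (int j - 1))
        = s powi (int (Suc i) * (int (Suc i) - 1) - int j * (int j + 1))"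
      by (simp add: power_int_add[symmetric] algebra_simps)
    then show ?thesis
      using qnum_nonzero[of "int i + 1"]
      by (simp add: u_def w_def t_def i qnum_fact_Suc field_simps)
  qed
  have v: "v (Suc j) = - w j" if j: "j < k" for j
  proof -
    obtain i where i: "k - j = Suc i" using j by (metis Suc_diff_Suc)
    have i': "k - Suc j = i" using i by simp
    have "s powi (2 * int i) * s powi (int i * (int i - 1) - int (Suc j) * (int (Suc j) - 1))
        = s powi (int (Suc i) * (int (Suc i) - 1) - int j * (int j + 1))"
      by (simp add: power_int_add[symmetric] algebra_simps)
    then show ?thesis
      using qnum_nonzero[of "int j + 1"]
      by (simp add: v_def w_def t_def i i' qnum_fact_Suc field_simps)
  qed
  have "qnum s (int k) * (\<Sum>j\<le>k. t j) = (\<Sum>j\<le>k. u j) + (\<Sum>j\<le>k. v j)"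
    by (simp add: sum_distrib_left split sum.distrib)
  \<comment> \<open>The end terms \<open>u k\<close> here and \<open>v 0\<close> below contain the
    factor \<open>[0] = 0\<close>.\<close>
  also have "(\<Sum>j\<le>k. u j) = (\<Sum>j<k. w j)"
    by (simp add: lessThan_Suc_atMost[symmetric] u) (simp add: u_def)
  also have "(\<Sum>j\<le>k. v j) = - (\<Sum>j<k. w j)"
  proof -
    have "(\<Sum>j\<le>k. v j) = v 0 + (\<Sum>j<k. v (Suc j))"
      by (simp only: lessThan_Suc_atMost[symmetric] sum.lessThan_Suc_shift)
    then show ?thesis by (simp add: v sum_negf) (simp add: v_def)
  qed
  finally have "(\<Sum>j\<le>k. t j) = 0" using qnum_nonzero[of "int k"] assms by simp
  moreover have "pos_coeff (k - j) * neg_coeff j = ?z ^ k * t j" if "j \<le> k" for j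
  proof -
    have "?z ^ k = ?z ^ (k - j) * ?z ^ j" using that by (simp add: power_add[symmetric])
    moreover have "s powi (int (k - j) * (int (k - j) - 1) - int j * (int j - 1))
        = s powi (int (k - j) * (int (k - j) - 1)) * s powi (- (int j * (int j - 1)))"
      by (simp add: power_int_add[symmetric])
    ultimately show ?thesis by (simp add: pos_coeff_def neg_coeff_def t_def)
  qed
  ultimately show ?thesis by (simp add: sum_distrib_left[symmetric])
qed

text \<open>The scalar in \<open>F^m v_a = F_coeff n a m v_(a+m)\<close>.\<close>

definition F_coeff :: "nat \<Rightarrow> nat \<Rightarrow> nat \<Rightarrow> 'a" where
  "F_coeff n a m = (\<Prod>t<m. qnum s (int (a + t) + 1) * qnum s (int n - int (a + t)))"

lemma F_coeff_0 [simp]: "F_coeff n a 0 = 1"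
  by (simp add: F_coeff_def)

lemma F_coeff_1: "F_coeff n a (Suc 0) = qnum s (int a + 1) * qnum s (int n - int a)"
  by (simp add: F_coeff_def)

lemma F_coeff_add: "F_coeff n a (i + j) = F_coeff n a i * F_coeff n (a + i) j"
proof (induction j)
  case (Suc j)
  then show ?case by (simp add: F_coeff_def mult_ac add.assoc)
qed simp

lemma F_coeff_eq:
  "F_coeff n a m * qnum_fact s a = qnum_fact s (a + m) * (\<Prod>t<m. qnum s (int n - int a - int t))"
proof (induction m)
  case (Suc m)
  have "F_coeff n a (Suc m) * qnum_fact s a
      = (F_coeff n a m * qnum_fact s a) * (qnum s (int (a + m) + 1) * qnum s (int n - int (a + m)))"
    by (simp add: F_coeff_def mult_ac)
  then show ?case unfolding Suc by (simp add: qnum_fact_Suc mult_ac algebra_simps)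
qed simp


section \<open>The R-matrix\<close>

lemma E_mat_power:
  assumes "i \<le> n" "j \<le> n"
  shows "(E_mat n ^\<^sub>m m :: 'a mat) $$ (i, j) = of_bool (i + m = j)"
  using assms
proof (induction m arbitrary: i j)
  case 0
  then show ?case by (simp add: E_mat_def one_mat_def)
next
  case (Suc m)
  have c: "(E_mat n :: 'a mat) \<in> carrier_mat (n + 1) (n + 1)" by (simp add: E_mat_def)
  have cm: "(E_mat n ^\<^sub>m m :: 'a mat) \<in> carrier_mat (n + 1) (n + 1)" using c by (rule pow_carrier_mat)
  have "(E_mat n ^\<^sub>m Suc m :: 'a mat) $$ (i, j)
      = (\<Sum>l<n+1. (E_mat n ^\<^sub>m m :: 'a mat) $$ (i, l) * E_mat n $$ (l, j))"
    using c cm Suc.prems by (simp add: scalar_prod_def lessThan_atLeast0)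
  also have "\<dots> = (\<Sum>l<n+1. if l = i + m then of_bool (Suc l = j) else 0)"
    using Suc by (intro sum.cong) (auto simp: E_mat_def)
  also have "\<dots> = of_bool (i + Suc m = j)"
    using Suc.prems by (auto simp: sum.delta)
  finally show ?case .
qed

lemma F_mat_power:
  assumes "i \<le> n" "j \<le> n"
  shows "(F_mat s n ^\<^sub>m m) $$ (i, j) = (if i = j + m then F_coeff n j m else 0)"
  using assms
proof (induction m arbitrary: i j)
  case 0
  then show ?case by (simp add: F_mat_def one_mat_def)
next
  case (Suc m)
  have c: "F_mat s n \<in> carrier_mat (n + 1) (n + 1)" by (simp add: F_mat_def)
  have cm: "F_mat s n ^\<^sub>m m \<in> carrier_mat (n + 1) (n + 1)" using c by (rule pow_carrier_mat)
  have F1: "F_coeff n j (Suc m) = F_coeff n j 1 * F_coeff n (Suc j) m"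
    using F_coeff_add[of n j 1 m] by simp
  have "(F_mat s n ^\<^sub>m Suc m) $$ (i, j)
      = (\<Sum>l<n+1. (F_mat s n ^\<^sub>m m) $$ (i, l) * F_mat s n $$ (l, j))"
    using c cm Suc.prems by (simp add: scalar_prod_def lessThan_atLeast0)
  also have "\<dots> = (\<Sum>l<n+1. if l = Suc j then (if i = l + m then F_coeff n l m else 0)
      * (qnum s (int j + 1) * qnum s (int n - int j)) else 0)"
    using Suc by (intro sum.cong) (auto simp: F_mat_def)
  also have "\<dots> = (if i = j + Suc m then F_coeff n j (Suc m) else 0)"
    using Suc.prems unfolding F1 by (auto simp: sum.delta F_coeff_1 mult_ac)
  finally show ?case .
qed

text \<open>\<open>E^m\<close> lowers the first index by \<open>m\<close> and \<open>F^m\<close>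
  raises the second by \<open>m\<close>. So an entry receives at most one summand,
  \<open>m = b - b'\<close>, and the diagonal factor sees the outgoing weights.\<close>

lemma R_mat_entry:
  assumes "b \<le> n" "a \<le> n" "b' \<le> n" "a' \<le> n"
  shows "R_mat s n $$ (b' * (n + 1) + a', b * (n + 1) + a) =
     (if b' \<le> b \<and> a' = a + (b - b')
      then s powi (weight n b' * weight n a') * pos_coeff (b - b') * F_coeff n a (b - b') else 0)"
proof -
  define d where "d = n + 1"
  have lt: "b < d" "a < d" "b' < d" "a' < d" using assms by (simp_all add: d_def)
  let ?M = "mat (d * d) (d * d) (\<lambda>ij.
     \<Sum>m\<le>n. (s powi 2 - s powi (- 2)) ^ m * s powi (int m * (int m - 1)) / qnum_fact s m
            * kron (E_mat n ^\<^sub>m m) (F_mat s n ^\<^sub>m m) $$ ij)"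
  have cE: "(E_mat n ^\<^sub>m m :: 'a mat) \<in> carrier_mat d d" for m
    by (rule pow_carrier_mat) (simp add: E_mat_def d_def)
  have cF: "F_mat s n ^\<^sub>m m \<in> carrier_mat d d" for m
    by (rule pow_carrier_mat) (simp add: F_mat_def d_def)
  have "kron (E_mat n ^\<^sub>m m) (F_mat s n ^\<^sub>m m) $$ (b' * d + a', b * d + a)
      = (E_mat n ^\<^sub>m m) $$ (b', b) * (F_mat s n ^\<^sub>m m) $$ (a', a)" for m
    using cE[of m] cF[of m] lt by (simp add: kron_pair_entry)
  then have K: "kron (E_mat n ^\<^sub>m m) (F_mat s n ^\<^sub>m m) $$ (b' * d + a', b * d + a)
      = of_bool (b' + m = b) * (if a' = a + m then F_coeff n a m else 0)" for m
    using assms by (simp add: E_mat_power F_mat_power)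
  have M: "?M $$ (b' * d + a', b * d + a) =
      (\<Sum>m\<le>n. if m = b - b' then (if b' \<le> b \<and> a' = a + m then pos_coeff m * F_coeff n a m else 0) else 0)"
    unfolding mat_pair_entry[OF lt(3,4,1,2)] K by (rule sum.cong) (auto simp: pos_coeff_def)
  have "R_mat s n $$ (b' * d + a', b * d + a) =
      (\<Sum>x<d. \<Sum>y<d. qHH_mat s n $$ (b' * d + a', x * d + y) * ?M $$ (x * d + y, b * d + a))"
    unfolding R_mat_def d_def[symmetric]
    by (rule mult_mat_pair_entry) (use lt in \<open>simp_all add: qHH_mat_def d_def\<close>)
  also have "\<dots> = (\<Sum>x<d. \<Sum>y<d. if y = a' then (if x = b'
      then s powi (weight n b' * weight n a') * ?M $$ (x * d + y, b * d + a) else 0) else 0)"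
    using lt unfolding qHH_mat_def d_def[symmetric]
    by (intro sum.cong refl) (auto simp: mat_pair_entry pair_eq_iff)
  also have "\<dots> = s powi (weight n b' * weight n a') * ?M $$ (b' * d + a', b * d + a)"
    using lt by simp
  finally have "R_mat s n $$ (b' * d + a', b * d + a) =
     (if b' \<le> b \<and> a' = a + (b - b')
      then s powi (weight n b' * weight n a') * pos_coeff (b - b') * F_coeff n a (b - b') else 0)"
    unfolding M using assms by (simp add: sum.delta)
  then show ?thesis by (simp only: d_def)
qed

lemma braiding_carrier: "braiding s n \<in> carrier_mat ((n + 1) * (n + 1)) ((n + 1) * (n + 1))"
  unfolding braiding_def R_mat_def flip_mat_def qHH_mat_def
  by (rule mult_carrier_mat[OF mat_carrier mult_carrier_mat[OF mat_carrier mat_carrier]])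

text \<open>The flip exchanges the outputs: the over-strand enters on the left with \<open>b\<close>
  and leaves on the right with \<open>y = b - m\<close>, the under-strand enters with
  \<open>a\<close> and leaves on the left with \<open>x = a + m\<close>.\<close>

lemma braiding_entry:
  assumes "b \<le> n" "a \<le> n" "x \<le> n" "y \<le> n"
  shows "braiding s n $$ (x * (n + 1) + y, b * (n + 1) + a) =
     (if y \<le> b \<and> x = a + (b - y)
      then s powi (weight n y * weight n x) * pos_coeff (b - y) * F_coeff n a (b - y) else 0)"
proof -
  define d where "d = n + 1"
  have lt: "b < d" "a < d" "x < d" "y < d" using assms by (simp_all add: d_def)
  have cR: "R_mat s n \<in> carrier_mat (d * d) (d * d)"
    unfolding R_mat_def qHH_mat_def d_def by (rule mult_carrier_mat[OF mat_carrier mat_carrier])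
  have "braiding s n $$ (x * d + y, b * d + a) =
      (\<Sum>u<d. \<Sum>v<d. flip_mat d $$ (x * d + y, u * d + v) * R_mat s n $$ (u * d + v, b * d + a))"
    unfolding braiding_def d_def[symmetric]
    by (rule mult_mat_pair_entry[OF _ cR]) (use lt in \<open>simp_all add: flip_mat_def\<close>)
  also have "\<dots> = (\<Sum>u<d. \<Sum>v<d. if v = x then (if u = y
      then R_mat s n $$ (u * d + v, b * d + a) else 0) else 0)"
    using lt unfolding flip_mat_def
    by (intro sum.cong refl) (auto simp: mat_pair_entry)
  also have "\<dots> = R_mat s n $$ (y * d + x, b * d + a)"
    using lt by simp
  finally show ?thesis unfolding d_def using R_mat_entry[OF assms(1,2,4,3)] by simp
qed

text \<open>The inverse of flip after R is the inverse of R after flip. In the inverse of R the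
  diagonal part acts first, so its exponent contains the incoming weights. This is the origin of the
  asymmetry between positive and negative crossings in the state sum.\<close>

definition neg_braiding :: "nat \<Rightarrow> 'a mat" where
  "neg_braiding n = mat ((n + 1) * (n + 1)) ((n + 1) * (n + 1)) (\<lambda>(i, j).
     let x = i div (n + 1); y = i mod (n + 1); a = j div (n + 1); b = j mod (n + 1)
     in if x \<le> b \<and> y = a + (b - x)
        then neg_coeff (b - x) * F_coeff n a (b - x) * s powi (- (weight n a * weight n b)) else 0)"

lemma neg_braiding_carrier: "neg_braiding n \<in> carrier_mat ((n + 1) * (n + 1)) ((n + 1) * (n + 1))"
  unfolding neg_braiding_def by (rule mat_carrier)

lemma neg_braiding_entry:
  assumes "a \<le> n" "b \<le> n" "x \<le> n" "y \<le> n"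
  shows "neg_braiding n $$ (x * (n + 1) + y, a * (n + 1) + b) =
     (if x \<le> b \<and> y = a + (b - x)
      then neg_coeff (b - x) * F_coeff n a (b - x) * s powi (- (weight n a * weight n b)) else 0)"
proof -
  define d where "d = n + 1"
  have lt: "a < d" "b < d" "x < d" "y < d" using assms by (simp_all add: d_def)
  have dm: "(x * d + y) div d = x" "(x * d + y) mod d = y" "(a * d + b) div d = a" "(a * d + b) mod d = b"
    using lt by simp_all
  show ?thesis
    unfolding neg_braiding_def d_def[symmetric] Let_def mat_pair_entry[OF lt(3,4,1,2)] prod.case dm
    by (rule refl)
qed

text \<open>Index conservation leaves one free intermediate label \<open>x\<close>, between
  \<open>t\<close> and \<open>b\<close>. As \<open>F_coeff\<close> is multiplicative,
  \<open>x\<close> enters only through the convolution of the two coefficient sequences, which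
  vanishes unless \<open>t = b\<close>.\<close>

lemma braiding_mult_neg_braiding: "braiding s n * neg_braiding n = 1\<^sub>m ((n + 1) * (n + 1))"
proof (rule eq_matI)
  define d where "d = n + 1"
  fix i j assume "i < dim_row (1\<^sub>m ((n + 1) * (n + 1)) :: 'a mat)"
    "j < dim_col (1\<^sub>m ((n + 1) * (n + 1)) :: 'a mat)"
  then have ij: "i < d * d" "j < d * d" by (simp_all add: d_def)
  define p t a b where "p = i div d" "t = i mod d" "a = j div d" "b = j mod d"
  have lt: "p < d" "t < d" "a < d" "b < d"
    using ij unfolding p_t_a_b_def by (auto simp: less_mult_imp_div_less d_def)
  have le: "p \<le> n" "t \<le> n" "a \<le> n" "b \<le> n" using lt by (simp_all add: d_def)
  have i: "i = p * d + t" and j: "j = a * d + b" unfolding p_t_a_b_def by simp_all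
  define c where "c x = s powi (weight n t * weight n p) * F_coeff n a (b - t) * s powi (- (weight n a * weight n b))
      * (pos_coeff (x - t) * neg_coeff (b - x))" for x
  have "(braiding s n * neg_braiding n) $$ (i, j)
      = (\<Sum>x<d. \<Sum>y<d. braiding s n $$ (p * d + t, x * d + y) * neg_braiding n $$ (x * d + y, a * d + b))"
    unfolding i j using lt braiding_carrier[of n] neg_braiding_carrier[of n]
    by (intro mult_mat_pair_entry) (simp_all only: d_def)
  also have "\<dots> = (\<Sum>x<d. \<Sum>y<d.
      if y = a + (b - x) then (if t \<le> x \<and> x \<le> b \<and> p = a + (b - t) then c x else 0) else 0)"
  proof (intro sum.cong refl)
    fix x y assume "x \<in> {..<d}" "y \<in> {..<d}"
    then have xy: "x \<le> n" "y \<le> n" by (auto simp: d_def)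
    \<comment> \<open>Raising by \<open>b - x\<close> and then by \<open>x - t\<close> raises by
      \<open>b - t\<close>, so the product does not depend on \<open>x\<close>.\<close>
    have "F_coeff n a (b - t) = F_coeff n a (b - x) * F_coeff n (a + (b - x)) (x - t)"
      if "t \<le> x" "x \<le> b"
      using F_coeff_add[of n a "b - x" "x - t"] that by simp
    then show "braiding s n $$ (p * d + t, x * d + y) * neg_braiding n $$ (x * d + y, a * d + b) =
      (if y = a + (b - x) then (if t \<le> x \<and> x \<le> b \<and> p = a + (b - t) then c x else 0) else 0)"
      unfolding d_def braiding_entry[OF xy le(1,2)] neg_braiding_entry[OF le(3,4) xy] c_def
      by auto
  qed
  also have "\<dots> = (\<Sum>x<d. if t \<le> x \<and> x \<le> b \<and> p = a + (b - t) then c x else 0)"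
  proof (intro sum.cong refl)
    fix x
    show "(\<Sum>y<d. if y = a + (b - x) then (if t \<le> x \<and> x \<le> b \<and> p = a + (b - t) then c x else 0) else 0)
        = (if t \<le> x \<and> x \<le> b \<and> p = a + (b - t) then c x else 0)"
    proof (cases "t \<le> x \<and> x \<le> b \<and> p = a + (b - t)")
      case True
      then have "a + (b - x) < d" using lt by linarith
      then show ?thesis using True by (simp add: sum.delta)
    next
      case False
      show ?thesis unfolding if_not_P[OF False] by simp
    qed
  qed
  also have "\<dots> = (if p = a + (b - t) \<and> t \<le> b then (\<Sum>x=t..b. c x) else 0)"
  proof (cases "p = a + (b - t) \<and> t \<le> b")
    case True
    have "(\<Sum>x<d. if t \<le> x \<and> x \<le> b \<and> p = a + (b - t) then c x else 0)
        = (\<Sum>x=t..b. if t \<le> x \<and> x \<le> b \<and> p = a + (b - t) then c x else 0)"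
      by (rule sum.mono_neutral_right) (use lt in auto)
    also have "\<dots> = (\<Sum>x=t..b. c x)"
      by (rule sum.cong) (use True in auto)
    finally show ?thesis using True by simp
  next
    case False
    then have "\<not> (t \<le> x \<and> x \<le> b \<and> p = a + (b - t))" for x by (meson le_trans)
    then show ?thesis unfolding if_not_P[OF False] by (simp only: if_False sum.neutral_const)
  qed
  also have "\<dots> = (if p = a + (b - t) \<and> t \<le> b then
      s powi (weight n t * weight n p) * F_coeff n a (b - t) * s powi (- (weight n a * weight n b))
      * of_bool (t = b) else 0)"
  proof -
    have "(\<Sum>x=t..b. pos_coeff (x - t) * neg_coeff (b - x)) = of_bool (t = b)" if "t \<le> b"
    proof -
      have "(\<Sum>x=t..b. pos_coeff (x - t) * neg_coeff (b - x))
          = (\<Sum>l\<le>b - t. pos_coeff (b - t - l) * neg_coeff l)"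
        by (rule sum.reindex_bij_witness[of _ "\<lambda>l. b - l" "\<lambda>x. b - x"]) (use that in auto)
      also have "\<dots> = of_bool (t = b)"
      proof (cases "t = b")
        case False
        then have "b - t > 0" using that by simp
        from coeff_convolution[OF this] show ?thesis using False by (simp only: of_bool_eq)
      qed simp
      finally show ?thesis .
    qed
    moreover have "(\<Sum>x=t..b. c x) = s powi (weight n t * weight n p) * F_coeff n a (b - t)
        * s powi (- (weight n a * weight n b)) * (\<Sum>x=t..b. pos_coeff (x - t) * neg_coeff (b - x))"
      unfolding sum_distrib_left by (rule sum.cong) (simp_all only: c_def)
    ultimately show ?thesis by presburger
  qed
  also have "\<dots> = of_bool (p = a \<and> t = b)"
    by (auto simp: power_int_add[symmetric] mult.commute)
  also have "p = a \<and> t = b \<longleftrightarrow> i = j"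
    unfolding i j using lt by (simp add: pair_eq_iff)
  finally show "(braiding s n * neg_braiding n) $$ (i, j) = 1\<^sub>m ((n + 1) * (n + 1)) $$ (i, j)"
    using ij unfolding d_def[symmetric] by simp
qed (use braiding_carrier[of n] neg_braiding_carrier[of n] in auto)

text \<open>A one-sided inverse of a square matrix over a field is two-sided, and a two-sided
  inverse is unique; this resolves the definite description.\<close>

lemma braiding_inv_eq: "braiding_inv s n = neg_braiding n"
  unfolding braiding_inv_def
proof (rule the_equality)
  define d where "d = (n + 1) * (n + 1)"
  note bc = braiding_carrier[of n, folded d_def] and c = neg_braiding_carrier[of n, folded d_def]
    and bn = braiding_mult_neg_braiding[of n, folded d_def]
  have inv: "neg_braiding n * braiding s n = 1\<^sub>m d"
    by (rule mat_mult_left_right_inverse[OF bc c bn])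
  show "neg_braiding n \<in> carrier_mat ((n + 1) * (n + 1)) ((n + 1) * (n + 1)) \<and>
     inverts_mat (braiding s n) (neg_braiding n) \<and> inverts_mat (neg_braiding n) (braiding s n)"
    using bc c inv bn unfolding d_def[symmetric] by (simp add: inverts_mat_def)
  fix B assume "B \<in> carrier_mat ((n + 1) * (n + 1)) ((n + 1) * (n + 1)) \<and>
     inverts_mat (braiding s n) B \<and> inverts_mat B (braiding s n)"
  then have B: "B \<in> carrier_mat d d" "inverts_mat B (braiding s n)" unfolding d_def by auto
  then have "B = B * (braiding s n * neg_braiding n)"
    by (simp add: bn)
  also have "\<dots> = (B * braiding s n) * neg_braiding n"
    using B c bc by (simp add: assoc_mult_mat[of _ d d _ d _ d])
  also have "\<dots> = neg_braiding n" using B c by (auto simp: inverts_mat_def)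
  finally show "B = neg_braiding n" .
qed

end

section \<open>Evaluation of the local factors of a state\<close>

lemma lquot_eqI: "c * g = f \<Longrightarrow> g \<noteq> 0 \<Longrightarrow> lquot f g = c"
  unfolding lquot_def by (rule the_equality) auto

lemma lquot_mult: "g dvd f \<Longrightarrow> g \<noteq> 0 \<Longrightarrow> lquot f g * g = f"
  by (metis lquot_eqI dvdE mult.commute)

definition qint :: "nat \<Rightarrow> int laurent" where
  "qint n = lquot (qbrace n) (qbrace 1)"

lemma qbrace_nonzero: "n > 0 \<Longrightarrow> qbrace n \<noteq> 0"
proof
  assume "n > 0" "qbrace n = 0"
  then have "Poly_Mapping.lookup (qbrace n) (int n) = 0" by simp
  then show False using \<open>n > 0\<close> by (simp add: qbrace_def lookup_minus lookup_single when_def)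
qed

lemma qbrace_add:
  "qbrace (a + b) = Poly_Mapping.single (- int b) 1 * qbrace a + Poly_Mapping.single (int a) 1 * qbrace b"
  by (simp add: qbrace_def right_diff_distrib mult_single algebra_simps)

lemma qbrace_1_dvd: "qbrace 1 dvd qbrace n"
proof (induction n)
  case (Suc n)
  then show ?case using qbrace_add[of n 1] by simp
qed (simp add: qbrace_def)

lemma qint_mult: "qint n * qbrace 1 = qbrace n"
  unfolding qint_def by (intro lquot_mult qbrace_1_dvd qbrace_nonzero) simp

lemma qint_add:
  "qint (a + b) = Poly_Mapping.single (- int b) 1 * qint a + Poly_Mapping.single (int a) 1 * qint b"
proof -
  have "qint (a + b) * qbrace 1 = (Poly_Mapping.single (- int b) 1 * qint a
      + Poly_Mapping.single (int a) 1 * qint b) * qbrace 1"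
    unfolding distrib_right mult.assoc qint_mult by (rule qbrace_add)
  then show ?thesis using qbrace_nonzero[of 1] by simp
qed

lemma qfact_Suc: "qfact (Suc n) = qfact n * qint (Suc n)"
  by (simp add: qfact_def qint_def)

lemma qfact_0 [simp]: "qfact 0 = 1"
  by (simp add: qfact_def)

lemma qint_nonzero: "n > 0 \<Longrightarrow> qint n \<noteq> 0"
  using qint_mult[of n] qbrace_nonzero[of n] by auto

lemma qfact_nonzero: "qfact n \<noteq> 0"
  by (induction n) (simp_all add: qfact_Suc qint_nonzero)

text \<open>Quantum Pascal rule: \<open>[a+b]!\<close> is a combination of
  \<open>[a] [a+b-1]!\<close> and \<open>[b] [a+b-1]!\<close>, and both are divisible by induction.
  Without divisibility the quotient \<open>lquot\<close> in \<open>qbinom\<close> would be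
  unspecified.\<close>

lemma qfact_mult_dvd: "qfact a * qfact b dvd qfact (a + b)"
proof (induction "a + b" arbitrary: a b)
  case (Suc n)
  show ?case
  proof (cases "a = 0 \<or> b = 0")
    case False
    then obtain a' b' where ab: "a = Suc a'" "b = Suc b'" by (metis not0_implies_Suc)
    have "qfact a' * qfact b dvd qfact n" "qfact a * qfact b' dvd qfact n"
      using Suc.hyps(1)[of a' b] Suc.hyps(1)[of a b'] Suc.hyps(2) ab by auto
    then have "qint a * (qfact a' * qfact b) dvd qint a * qfact n"
        "qint b * (qfact a * qfact b') dvd qint b * qfact n"
      by (simp_all only: mult_dvd_mono dvd_refl)
    then have "qfact a * qfact b dvd qint a * qfact n" "qfact a * qfact b dvd qint b * qfact n"
      by (simp_all add: ab qfact_Suc mult_ac)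
    from dvd_add[OF dvd_mult[OF this(1)] dvd_mult[OF this(2)]]
    have "qfact a * qfact b dvd Poly_Mapping.single (- int b) 1 * (qint a * qfact n)
        + Poly_Mapping.single (int a) 1 * (qint b * qfact n)" .
    also have "\<dots> = qfact (a + b)"
      unfolding Suc.hyps(2)[symmetric] qfact_Suc unfolding Suc.hyps(2) qint_add
      by (simp add: algebra_simps)
    finally show ?thesis .
  qed auto
qed simp

lemma qbinom_mult: "qbinom (a + m) m * (qfact a * qfact m) = qfact (a + m)"
  unfolding qbinom_def using qfact_mult_dvd[of a m] qfact_nonzero
  by (simp add: lquot_mult)

section \<open>Evaluation at \<open>q = s^2\<close>, \<open>A = q^n\<close>\<close>

context generic_q
begin

definition q_eval :: "int laurent \<Rightarrow> 'a" where
  "q_eval = laurent_eval of_int (s powi 2)"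

lemma q_nonzero: "s powi 2 \<noteq> 0"
  by simp

interpretation q_eval: comm_ring_hom q_eval
  unfolding q_eval_def by (rule laurent_eval_hom[OF comm_ring_hom_of_int q_nonzero])

lemma q_eval_single: "q_eval (Poly_Mapping.single k 1) = s powi (2 * k)"
  by (simp only: q_eval_def laurent_eval_single[OF comm_ring_hom_of_int q_nonzero] power_int_mult of_int_1 mult_1)

lemma q_eval_qint: "q_eval (qint n) = qnum s (int n)"
proof -
  have b: "q_eval (qbrace n) = s powi (2 * int n) - s powi (- 2 * int n)" for n
    by (simp add: qbrace_def q_eval.hom_minus q_eval_single)
  have "q_eval (qint n) * q_eval (qbrace 1) = q_eval (qbrace n)"
    by (simp only: q_eval.hom_mult[symmetric] qint_mult)
  then show ?thesis using generic[of 1] unfolding b qnum_def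
    by (simp add: field_simps)
qed

lemma q_eval_qfact: "q_eval (qfact n) = qnum_fact s n"
  by (induction n) (simp_all add: qfact_Suc q_eval.hom_mult q_eval_qint qnum_fact_Suc add.commute)

lemma q_eval_qbinom: "q_eval (qbinom (a + m) m) = qnum_fact s (a + m) / (qnum_fact s a * qnum_fact s m)"
proof -
  have "q_eval (qbinom (a + m) m) * (q_eval (qfact a) * q_eval (qfact m)) = q_eval (qfact (a + m))"
    by (simp only: q_eval.hom_mult[symmetric] qbinom_mult)
  then show ?thesis using qnum_fact_nonzero by (simp add: q_eval_qfact field_simps)
qed

definition eval_at :: "nat \<Rightarrow> qA_ring \<Rightarrow> 'a" where
  "eval_at n = qA_eval (s powi 2) (s powi (2 * int n))"

lemma eval_at_hom: "comm_ring_hom (eval_at n)"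
  unfolding eval_at_def by (rule qA_eval_hom) simp_all

lemma eval_at_mon: "eval_at n (mon x y) = s powi (2 * (x + y * int n))"
proof -
  have "eval_at n (mon x y) = s powi (2 * x) * s powi (2 * int n * y)"
    unfolding eval_at_def power_int_mult by (rule qA_eval_mon) simp_all
  then show ?thesis by (simp add: power_int_add[symmetric] algebra_simps)
qed

interpretation eval_at: comm_ring_hom "eval_at n" for n
  by (rule eval_at_hom)

lemma eval_at_abrace:
  "eval_at n (abrace (- int a) m) =
     (s powi 2 - s powi (- 2)) ^ m * (\<Prod>t<m. qnum s (int n - int a - int t))"
proof -
  have "eval_at n (mon (- int a - int t) 1 - mon (int t - - int a) (- 1))
      = (s powi 2 - s powi (- 2)) * qnum s (int n - int a - int t)" for t
  proof -
    have "s powi 2 - s powi (- 2) \<noteq> 0" using generic[of 1] by simp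
    moreover have "2 * (- int a - int t + 1 * int n) = 2 * (int n - int a - int t)"
      "2 * (int t - - int a + (- 1) * int n) = - 2 * (int n - int a - int t)" by simp_all
    ultimately show ?thesis
      unfolding eval_at.hom_minus eval_at_mon qnum_def 
      by (simp only: times_divide_eq_right nonzero_mult_div_cancel_left not_False_eq_True)
  qed
  then show ?thesis by (simp add: abrace_def eval_at.hom_prod prod.distrib)
qed

text \<open>The factor with \<open>t = n - a\<close> is \<open>{0}\<close>. This is what stops a
  label from passing from at most \<open>n\<close> to above \<open>n\<close>.\<close>

lemma eval_at_abrace_eq_0:
  assumes "a \<le> n" "n < a + m"
  shows "eval_at n (abrace (- int a) m) = 0"
proof -
  have "n - a \<in> {..<m}" "qnum s (int n - int a - int (n - a)) = 0" using assms by auto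
  then have "(\<Prod>t<m. qnum s (int n - int a - int t)) = 0" by (meson finite_lessThan prod_zero)
  then show ?thesis unfolding eval_at_abrace by simp
qed

text \<open>The right-hand side is the R-matrix coefficient without its power of \<open>q\<close>,
  times the matrix entry of \<open>F^m\<close>. The rising product \<open>[a+1]...[a+m]\<close> in
  that entry, divided by \<open>[m]!\<close>, is the binomial; the falling product times
  \<open>{1}^m\<close> is the brace.\<close>

lemma eval_at_common:
  "eval_at n (Poly_Mapping.single 0 (qbinom (a + m) m) * abrace (- int a) m) =
     (s powi 2 - s powi (- 2)) ^ m / qnum_fact s m * F_coeff n a m"
proof -
  have "F_coeff n a m = qnum_fact s (a + m) * (\<Prod>t<m. qnum s (int n - int a - int t)) / qnum_fact s a"
    using F_coeff_eq[of n a m] qnum_fact_nonzero[of a] by (simp add: field_simps)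
  then show ?thesis
    unfolding eval_at.hom_mult eval_at_abrace
    by (simp add: eval_at_def qA_eval_single[OF q_nonzero] q_eval_def[symmetric] q_eval_qbinom mult_ac
        del: power_int_numeral)
qed

text \<open>Here and in \<open>neg_weight\<close>, \<open>a\<close> is the incoming label of the
  under-strand and \<open>b\<close> that of the over-strand.\<close>

definition pos_weight :: "nat \<Rightarrow> nat \<Rightarrow> nat \<Rightarrow> nat \<Rightarrow> 'a" where
  "pos_weight n a b m = s powi (weight n (b - m) * weight n (a + m)) * pos_coeff m * F_coeff n a m"

definition neg_weight :: "nat \<Rightarrow> nat \<Rightarrow> nat \<Rightarrow> nat \<Rightarrow> 'a" where
  "neg_weight n a b m = neg_coeff m * F_coeff n a m * s powi (- (weight n a * weight n b))"

text \<open>As powers of \<open>s = q^(1/2)\<close>, the three parts are the framing factor,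
  \<open>q^(-(a+b)n)\<close> and \<open>q^(2ab)\<close>.\<close>

lemma weight_mult:
  "weight n a * weight n b = int n * int n + (- 2 * (int a + int b) * int n + 4 * int a * int b)"
  by (simp add: weight_def algebra_simps)

lemma eval_at_pos:
  assumes "m \<le> b"
  shows "pos_weight n a b m = s powi (int n * int n) *
    eval_at n (mon (int m * (int m - 1) div 2) 0
      * (Poly_Mapping.single 0 (qbinom (a + m) m) * abrace (- int a) m) * mon 0 (- (int a + int b))
      * mon (2 * (int a + int m) * (int b - int m)) 0)"
proof -
  have "even (int m * (int m - 1))" by simp
  then have e: "2 * (int m * (int m - 1) div 2) = int m * (int m - 1)" by simp
  \<comment> \<open>The sum of the labels is conserved at a crossing, so the linear part can be
    written in the incoming labels, while the quadratic part keeps the outgoing ones.\<close>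
  have w: "weight n (b - m) * weight n (a + m) = int n * int n + (2 * (- (int a + int b) * int n)
      + 2 * (2 * (int a + int m) * (int b - int m)))"
    using assms by (simp add: weight_mult of_nat_diff algebra_simps)
  show ?thesis
    \<comment> \<open>The restricted instances of \<open>hom_mult\<close> split every product except
      the one that \<open>eval_at_common\<close> treats as a whole.\<close>
    unfolding pos_weight_def w pos_coeff_def
      eval_at.hom_mult[of _ "_ * mon _ _"] eval_at.hom_mult[of _ "mon _ _"]
      eval_at.hom_mult[of _ "mon _ _ * _"] eval_at.hom_mult[of _ "_ * _"] eval_at_common eval_at_mon
    by (simp add: e power_int_add mult_ac)
qed

lemma eval_at_neg:
  "neg_weight n a b m = s powi (- (int n * int n)) *
    eval_at n ((- 1) ^ m * mon (- (int m * (int m - 1) div 2)) 0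
      * (Poly_Mapping.single 0 (qbinom (a + m) m) * abrace (- int a) m) * mon 0 (int a + int b)
      * mon (- 2 * int a * int b) 0)"
proof -
  have "even (int m * (int m - 1))" by simp
  then have e: "2 * (int m * (int m - 1) div 2) = int m * (int m - 1)" by simp
  have w: "- (weight n a * weight n b) = - (int n * int n) + (2 * ((int a + int b) * int n)
      + 2 * (- 2 * int a * int b))"
    by (simp add: weight_mult algebra_simps)
  have exponents: "2 * (- (int m * (int m - 1) div 2) + 0 * int n) = - (int m * (int m - 1))"
    "2 * (0 + (int a + int b) * int n) = 2 * ((int a + int b) * int n)"
    "2 * (- 2 * int a * int b + 0 * int n) = 2 * (- 2 * int a * int b)"
    using e by simp_all
  have "s powi (- (weight n a * weight n b)) = s powi (- (int n * int n))
      * (s powi (2 * ((int a + int b) * int n)) * s powi (2 * (- 2 * int a * int b)))"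
    unfolding w by (simp only: power_int_add s_nonzero simp_thms)
  then show ?thesis
    unfolding neg_weight_def neg_coeff_def
      eval_at.hom_mult[of _ "_ * mon _ _"] eval_at.hom_mult[of _ "mon _ _"]
      eval_at.hom_mult[of _ "(- 1) ^ _"]
      eval_at.hom_mult[of _ "_ * _"] eval_at_common eval_at_mon eval_at.hom_power eval_at.hom_uminus
      eval_at.hom_one exponents
    by (simp only: ac_simps times_divide_eq_left times_divide_eq_right)
qed

end

section \<open>The state sum of the Reshetikhin--Turaev operator\<close>

fun enc :: "nat \<Rightarrow> nat list \<Rightarrow> nat" where
  "enc d [] = 0"
| "enc d (a # w) = a * d ^ length w + enc d w"

definition label_words :: "nat \<Rightarrow> nat \<Rightarrow> nat list set" where
  "label_words d k = {w. set w \<subseteq> {..<d} \<and> length w = k}"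

lemma enc_append: "enc d (u @ v) = enc d u * d ^ length v + enc d v"
  by (induction u) (simp_all add: power_add algebra_simps)

lemma label_words_Cons: "a # w \<in> label_words d (Suc k) \<longleftrightarrow> a < d \<and> w \<in> label_words d k"
  by (auto simp: label_words_def)

lemma finite_label_words [simp]: "finite (label_words d k)"
  unfolding label_words_def by (rule finite_lists_length_eq) simp

lemma digit_div: "r < m \<Longrightarrow> (a * m + r) div m = (a :: nat)"
  by simp

lemma enc_less: "w \<in> label_words d k \<Longrightarrow> enc d w < d ^ k"
proof (induction w arbitrary: k)
  case (Cons a w)
  then obtain k' where k: "k = Suc k'" by (cases k) (auto simp: label_words_def)
  have "a < d" "enc d w < d ^ k'" "length w = k'"
    using Cons k by (auto simp: label_words_Cons) (simp add: label_words_def)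
  then show ?case using digit_less by (simp add: k)
qed (auto simp: label_words_def)

lemma enc_inj: "inj_on (enc d) (label_words d k)"
proof (rule inj_onI)
  fix u v show "u \<in> label_words d k \<Longrightarrow> v \<in> label_words d k \<Longrightarrow> enc d u = enc d v \<Longrightarrow> u = v"
  proof (induction u arbitrary: v k)
    case (Cons a u)
    obtain k' where k: "k = Suc k'" using Cons.prems(1) by (cases k) (auto simp: label_words_def)
    obtain b v' where v: "v = b # v'" using Cons.prems(2) k by (cases v) (auto simp: label_words_def)
    have w: "u \<in> label_words d k'" "v' \<in> label_words d k'"
      using Cons.prems k v by (simp_all add: label_words_Cons)
    then have lt: "enc d u < d ^ k'" "enc d v' < d ^ k'" and len: "length u = k'" "length v' = k'"
      by (auto intro: enc_less) (simp_all add: label_words_def)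
    have "a * d ^ k' + enc d u = b * d ^ k' + enc d v'" using Cons.prems(3) by (simp add: v len)
    from pair_eq_iff[OF lt, THEN iffD1, OF this] show ?case using Cons.IH w v by auto
  qed (auto simp: label_words_def)
qed

lemma enc_image: "enc d ` label_words d k = {..<d ^ k}"
proof (rule card_subset_eq)
  show "enc d ` label_words d k \<subseteq> {..<d ^ k}" using enc_less by auto
  have "card (enc d ` label_words d k) = card (label_words d k)" by (rule card_image[OF enc_inj])
  also have "\<dots> = d ^ k" by (simp add: label_words_def card_lists_length_eq)
  finally show "card (enc d ` label_words d k) = card {..<d ^ k}" by simp
qed simp

text \<open>Turns the summation index of a matrix product into a labeling of one level of the
  diagram.\<close>

lemma sum_enc: "(\<Sum>i<d ^ k. f i) = (\<Sum>w\<in>label_words d k. f (enc d w))"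
  unfolding enc_image[symmetric] by (simp add: sum.reindex[OF enc_inj])

lemma kron_carrier:
  "A \<in> carrier_mat a b \<Longrightarrow> B \<in> carrier_mat c e \<Longrightarrow> kron A B \<in> carrier_mat (a * c) (b * e)"
  by (auto simp: kron_def)

lemma kron_enc:
  assumes "A \<in> carrier_mat (d ^ k) (d ^ l)" "B \<in> carrier_mat (d ^ k') (d ^ l')"
    and "u \<in> label_words d k" "v \<in> label_words d l" "u' \<in> label_words d k'" "v' \<in> label_words d l'"
  shows "kron A B $$ (enc d (u @ u'), enc d (v @ v')) = A $$ (enc d u, enc d v) * B $$ (enc d u', enc d v')"
proof -
  have len: "length u' = k'" "length v' = l'" using assms by (simp_all add: label_words_def)
  have lt: "enc d u < d ^ k" "enc d v < d ^ l" "enc d u' < d ^ k'" "enc d v' < d ^ l'"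
    using assms enc_less by blast+
  have "enc d u * d ^ k' + enc d u' < d ^ k * d ^ k'" "enc d v * d ^ l' + enc d v' < d ^ l * d ^ l'"
    using lt digit_less by blast+
  moreover have "(enc d u * d ^ k' + enc d u') div d ^ k' = enc d u" "(enc d u * d ^ k' + enc d u') mod d ^ k' = enc d u'"
      "(enc d v * d ^ l' + enc d v') div d ^ l' = enc d v" "(enc d v * d ^ l' + enc d v') mod d ^ l' = enc d v'"
    using lt by (simp_all add: digit_div)
  ultimately show ?thesis using assms(1,2) unfolding kron_def by (simp add: enc_append len)
qed

lemma one_mat_enc:
  "u \<in> label_words d k \<Longrightarrow> v \<in> label_words d k \<Longrightarrow>
    1\<^sub>m (d ^ k) $$ (enc d u, enc d v) = of_bool (u = v)"
  using enc_less[of u d k] enc_less[of v d k] inj_onD[OF enc_inj, of d u v k] by auto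

definition layer_entry :: "'a::field \<Rightarrow> nat \<Rightarrow> layer \<Rightarrow> nat list \<Rightarrow> nat list \<Rightarrow> 'a" where
  "layer_entry s n = (\<lambda>(u, e, v) w w'. let p = length u; k = length (lower e); k' = length (upper e) in
     of_bool (take p w = take p w' \<and> drop (p + k) w = drop (p + k') w')
       * elem_mat s n e $$ (enc (n + 1) (take k' (drop p w')), enc (n + 1) (take k (drop p w))))"

definition layer_mat :: "'a::field \<Rightarrow> nat \<Rightarrow> layer \<Rightarrow> 'a mat" where
  "layer_mat s n = (\<lambda>(u, e, v). kron (1\<^sub>m ((n + 1) ^ length u))
     (kron (elem_mat s n e) (1\<^sub>m ((n + 1) ^ length v))))"

definition lower_word :: "layer \<Rightarrow> orientation list" where
  "lower_word = (\<lambda>(u, e, v). u @ lower e @ v)"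

definition upper_word :: "layer \<Rightarrow> orientation list" where
  "upper_word = (\<lambda>(u, e, v). u @ upper e @ v)"

text \<open>A path lists the label words of all levels, from the bottom, which carries \<open>w\<close>, to the top.\<close>

fun label_paths :: "nat \<Rightarrow> diagram \<Rightarrow> nat list \<Rightarrow> nat list list set" where
  "label_paths n [] w = (if w = [0] then {[w]} else {})"
| "label_paths n (L # D) w =
     (\<Union>w' \<in> label_words (n + 1) (length (upper_word L)). (#) w ` label_paths n D w')"

lemma label_paths_hd: "cs \<in> label_paths n D w \<Longrightarrow> cs \<noteq> [] \<and> hd cs = w"
  by (cases D) (auto split: if_splits)

lemma finite_label_paths [simp]: "finite (label_paths n D w)"
  by (induction D arbitrary: w) auto

lemma label_paths_iff:
  "cs \<in> label_paths n D w \<longleftrightarrow> length cs = Suc (length D) \<and> cs ! 0 = w \<and> cs ! length D = [0] \<and>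
     (\<forall>l < length D. cs ! Suc l \<in> label_words (n + 1) (length (upper_word (D ! l))))"
proof (induction D arbitrary: cs w)
  case Nil
  then show ?case by (auto simp: length_Suc_conv)
next
  case (Cons L D)
  show ?case
  proof (cases cs)
    case (Cons c cs')
    have "cs \<in> label_paths n (L # D) w \<longleftrightarrow> c = w \<and>
        (\<exists>w' \<in> label_words (n + 1) (length (upper_word L)). cs' \<in> label_paths n D w')"
      using Cons by auto
    also have "\<dots> \<longleftrightarrow> length cs = Suc (length (L # D)) \<and> cs ! 0 = w \<and> cs ! length (L # D) = [0] \<and>
     (\<forall>l < length (L # D). cs ! Suc l \<in> label_words (n + 1) (length (upper_word ((L # D) ! l))))"
      unfolding Cons.IH by (auto simp: Cons All_less_Suc2)
    finally show ?thesis .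
  qed auto
qed

context generic_q
begin

lemma elem_mat_carrier: "elem_mat s n e \<in> carrier_mat ((n + 1) ^ length (upper e)) ((n + 1) ^ length (lower e))"
  using braiding_carrier[of n] neg_braiding_carrier[of n]
  by (cases e) (simp_all add: braiding_inv_eq power2_eq_square)

lemma layer_mat_carrier:
  "layer_mat s n L \<in> carrier_mat ((n + 1) ^ length (upper_word L)) ((n + 1) ^ length (lower_word L))"
proof -
  obtain u e v where L: "L = (u, e, v)" by (cases L)
  have "layer_mat s n L \<in> carrier_mat ((n + 1) ^ length u * ((n + 1) ^ length (upper e) * (n + 1) ^ length v))
      ((n + 1) ^ length u * ((n + 1) ^ length (lower e) * (n + 1) ^ length v))"
    unfolding L layer_mat_def prod.case by (intro kron_carrier elem_mat_carrier one_carrier_mat)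
  then show ?thesis by (simp only: L upper_word_def lower_word_def prod.case length_append power_add)
qed

lemma layer_mat_entry:
  assumes "w \<in> label_words (n + 1) (length (lower_word L))" "w' \<in> label_words (n + 1) (length (upper_word L))"
  shows "layer_mat s n L $$ (enc (n + 1) w', enc (n + 1) w) = layer_entry s n L w w'"
proof -
  obtain u e v where L: "L = (u, e, v)" by (cases L)
  let ?p = "length u" and ?k = "length (lower e)" and ?k' = "length (upper e)" and ?r = "length v"
  define d where "d = n + 1"
  define a b c a' b' c' where "a = take ?p w" "b = take ?k (drop ?p w)" "c = drop (?p + ?k) w"
    and "a' = take ?p w'" "b' = take ?k' (drop ?p w')" "c' = drop (?p + ?k') w'"
  note defs = this
  have w: "w = a @ b @ c" and w': "w' = a' @ b' @ c'"
    unfolding defs by (metis add.commute append_take_drop_id drop_drop)+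
  have len: "length w = ?p + (?k + ?r)" "length w' = ?p + (?k' + ?r)"
    using assms by (auto simp: label_words_def L lower_word_def upper_word_def)
  have "set w \<subseteq> {..<d}" "set w' \<subseteq> {..<d}"
    using assms by (auto simp: label_words_def d_def)
  then have lw: "a \<in> label_words d ?p" "b \<in> label_words d ?k" "c \<in> label_words d ?r"
    "a' \<in> label_words d ?p" "b' \<in> label_words d ?k'" "c' \<in> label_words d ?r"
    using len by (auto simp: label_words_def defs dest: in_set_takeD in_set_dropD)
  then have lw2: "b @ c \<in> label_words d (?k + ?r)" "b' @ c' \<in> label_words d (?k' + ?r)"
    by (auto simp: label_words_def)
  have ce: "elem_mat s n e \<in> carrier_mat (d ^ ?k') (d ^ ?k)"
    unfolding d_def by (rule elem_mat_carrier)
  have cm: "kron (elem_mat s n e) (1\<^sub>m (d ^ ?r)) \<in> carrier_mat (d ^ (?k' + ?r)) (d ^ (?k + ?r))"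
    unfolding power_add by (intro kron_carrier ce one_carrier_mat)
  have "layer_mat s n L $$ (enc d w', enc d w) =
      of_bool (a' = a) * (elem_mat s n e $$ (enc d b', enc d b) * of_bool (c' = c))"
    unfolding L layer_mat_def prod.case d_def[symmetric] w w'
    by (subst kron_enc[OF one_carrier_mat cm lw(4,1) lw2(2,1)])
       (subst kron_enc[OF ce one_carrier_mat lw(5,2,6,3)], simp add: one_mat_enc lw)
  also have "\<dots> = of_bool (a = a' \<and> c = c') * elem_mat s n e $$ (enc d b', enc d b)"
    by (cases "a = a'"; cases "c = c'") simp_all
  also have "\<dots> = layer_entry s n L w w'"
    unfolding layer_entry_def L prod.case Let_def defs d_def by (rule refl)
  finally show ?thesis unfolding d_def .
qed

lemma RT_mat_carrier:
  "tangle D w [Up] \<Longrightarrow> RT_mat s n D \<in> carrier_mat (n + 1) ((n + 1) ^ length w)"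
proof (induction D arbitrary: w)
  case (Cons L D)
  obtain u e v where L: "L = (u, e, v)" by (cases L)
  have "RT_mat s n (L # D) = RT_mat s n D * layer_mat s n L" by (simp add: L layer_mat_def)
  moreover have "RT_mat s n D \<in> carrier_mat (n + 1) ((n + 1) ^ length (upper_word L))"
    using Cons by (intro Cons.IH) (simp add: L upper_word_def)
  moreover have "w = lower_word L" using Cons.prems by (simp add: L lower_word_def)
  ultimately show ?case using layer_mat_carrier by (metis mult_carrier_mat)
qed auto

text \<open>Multiplying out the matrix product gives one summand for each choice of a basis vector
  at every intermediate level. The bottom layer acts first and is the rightmost factor, so the
  induction on the diagram peels it off.\<close>

lemma RT_mat_entry:
  assumes "tangle D wd [Up]" "w \<in> label_words (n + 1) (length wd)"
  shows "RT_mat s n D $$ (0, enc (n + 1) w) =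
    (\<Sum>cs \<in> label_paths n D w. \<Prod>l<length D. layer_entry s n (D ! l) (cs ! l) (cs ! Suc l))"
  using assms
proof (induction D arbitrary: w wd)
  case Nil
  then obtain a where "w = [a]" "a < n + 1" by (auto simp: label_words_def length_Suc_conv)
  then show ?case by auto
next
  case (Cons L D)
  obtain u e v where L: "L = (u, e, v)" by (cases L)
  define d where "d = n + 1"
  let ?k = "length (upper_word L)"
  have wd: "wd = lower_word L" and t: "tangle D (upper_word L) [Up]"
    using Cons.prems(1) by (simp_all add: L lower_word_def upper_word_def)
  have cD: "RT_mat s n D \<in> carrier_mat d (d ^ ?k)"
    unfolding d_def by (rule RT_mat_carrier[OF t])
  have cL: "layer_mat s n L \<in> carrier_mat (d ^ ?k) (d ^ length wd)"
    unfolding d_def wd by (rule layer_mat_carrier)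
  have lt: "enc d w < d ^ length wd" using Cons.prems(2) unfolding d_def by (rule enc_less)
  have d0: "0 < d" by (simp add: d_def)
  have "RT_mat s n (L # D) $$ (0, enc d w) = (RT_mat s n D * layer_mat s n L) $$ (0, enc d w)"
    by (simp add: L layer_mat_def)
  also have "\<dots> = (\<Sum>i<d ^ ?k. RT_mat s n D $$ (0, i) * layer_mat s n L $$ (i, enc d w))"
    using cD cL lt d0 by (simp add: scalar_prod_def lessThan_atLeast0)
  also have "\<dots> = (\<Sum>w'\<in>label_words d ?k. RT_mat s n D $$ (0, enc d w') * layer_entry s n L w w')"
    unfolding sum_enc d_def using Cons.prems(2) by (intro sum.cong refl) (simp only: layer_mat_entry wd)
  also have "\<dots> = (\<Sum>w'\<in>label_words d ?k. \<Sum>cs \<in> label_paths n D w'.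
      \<Prod>l<length (L # D). layer_entry s n ((L # D) ! l) ((w # cs) ! l) ((w # cs) ! Suc l))"
  proof (intro sum.cong refl)
    fix w' assume w': "w' \<in> label_words d ?k"
    have "RT_mat s n D $$ (0, enc d w') * layer_entry s n L w w' =
      (\<Sum>cs \<in> label_paths n D w'. layer_entry s n L w w' *
        (\<Prod>l<length D. layer_entry s n (D ! l) (cs ! l) (cs ! Suc l)))"
      using Cons.IH[OF t, of w'] w' by (simp add: d_def sum_distrib_left mult.commute)
    also have "\<dots> = (\<Sum>cs \<in> label_paths n D w'.
      \<Prod>l<length (L # D). layer_entry s n ((L # D) ! l) ((w # cs) ! l) ((w # cs) ! Suc l))"
      using label_paths_hd by (intro sum.cong refl) (force simp: prod.lessThan_Suc_shift hd_conv_nth simp del: prod.lessThan_Suc)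
    finally show "RT_mat s n D $$ (0, enc d w') * layer_entry s n L w w' = \<dots>" .
  qed
  also have "\<dots> = (\<Sum>w'\<in>label_words d ?k. \<Sum>cs \<in> (#) w ` label_paths n D w'.
      \<Prod>l<length (L # D). layer_entry s n ((L # D) ! l) (cs ! l) (cs ! Suc l))"
    by (simp only: sum.reindex inj_on_Cons1 comp_def)
  also have "\<dots> = (\<Sum>cs \<in> label_paths n (L # D) w.
      \<Prod>l<length (L # D). layer_entry s n ((L # D) ! l) (cs ! l) (cs ! Suc l))"
  proof -
    \<comment> \<open>A path over \<open>D\<close> remembers its bottom word, so different words
      give disjoint sets of paths.\<close>
    have "(#) w ` label_paths n D a \<inter> (#) w ` label_paths n D b = {}" if "a \<noteq> b" for a b
      using label_paths_hd that by blast
    then show ?thesis by (simp add: d_def sum.UNION_disjoint)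
  qed
  finally show ?case by (simp add: d_def)
qed

end

section \<open>The open strand\<close>

text \<open>The top level has no layer above it to read the word from; its word is that of the upper
  endpoint.\<close>

definition level_word :: "diagram \<Rightarrow> nat \<Rightarrow> orientation list" where
  "level_word D l =
     (if l < length D then fst (D ! l) @ lower (elem_at D l) @ snd (snd (D ! l)) else [Up])"

abbreviation right_width :: "diagram \<Rightarrow> nat \<Rightarrow> nat" where
  "right_width D l \<equiv> length (snd (snd (D ! l)))"

lemma tangle_level_word:
  assumes "tangle D w [Up]"
  shows "level_word D 0 = w"
    and "l < length D \<Longrightarrow> level_word D (Suc l) = fst (D ! l) @ upper (elem_at D l) @ snd (snd (D ! l))"
proof -
  have "level_word D 0 = w \<and>
    (\<forall>l<length D. level_word D (Suc l) = fst (D ! l) @ upper (elem_at D l) @ snd (snd (D ! l)))"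
    using assms
  proof (induction D arbitrary: w)
    case Nil
    then show ?case by (simp add: level_word_def)
  next
    case (Cons a D)
    obtain u e v where a: "a = (u, e, v)" by (cases a)
    have shift: "level_word (b # D) (Suc l) = level_word D l" for b l
      by (simp add: level_word_def elem_at_def)
    have "level_word D 0 = u @ upper e @ v \<and>
      (\<forall>l<length D. level_word D (Suc l) = fst (D ! l) @ upper (elem_at D l) @ snd (snd (D ! l)))"
      using Cons a by auto
    then have "level_word (a # D) (Suc l) = fst ((a # D) ! l) @ upper (elem_at (a # D) l) @ snd (snd ((a # D) ! l))"
      if "l < length (a # D)" for l
      using that by (cases l) (auto simp: shift a elem_at_def)
    moreover have "level_word (a # D) 0 = w"
      using Cons.prems by (simp add: level_word_def elem_at_def a)
    ultimately show ?case by blast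
  qed
  then show "level_word D 0 = w"
    "l < length D \<Longrightarrow> level_word D (Suc l) = fst (D ! l) @ upper (elem_at D l) @ snd (snd (D ! l))"
    by blast+
qed

type_synonym position = "nat \<times> nat \<times> orientation"

text \<open>\<open>step\<close> is a total function with arbitrary values off the diagram. The
  relation keeps the moves that follow the orientations, with one rule for each kind of strand
  piece, so that facts about moves can be proved by cases.\<close>

inductive next_position :: "diagram \<Rightarrow> position \<Rightarrow> position \<Rightarrow> bool" for D where
  left_up: "l < length D \<Longrightarrow> x < left_width D l \<Longrightarrow> fst (D ! l) ! x = Up
    \<Longrightarrow> next_position D (l, x, Up) (Suc l, x, Up)"
| left_down: "l < length D \<Longrightarrow> x < left_width D l \<Longrightarrow> fst (D ! l) ! x = Down
    \<Longrightarrow> next_position D (Suc l, x, Down) (l, x, Down)"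
| right_up: "l < length D \<Longrightarrow> y < right_width D l \<Longrightarrow> snd (snd (D ! l)) ! y = Up
    \<Longrightarrow> next_position D (l, left_width D l + length (lower (elem_at D l)) + y, Up)
          (Suc l, left_width D l + length (upper (elem_at D l)) + y, Up)"
| right_down: "l < length D \<Longrightarrow> y < right_width D l \<Longrightarrow> snd (snd (D ! l)) ! y = Down
    \<Longrightarrow> next_position D (Suc l, left_width D l + length (upper (elem_at D l)) + y, Down)
          (l, left_width D l + length (lower (elem_at D l)) + y, Down)"
| crossing_right: "l < length D \<Longrightarrow> elem_at D l \<in> {Pos, Neg}
    \<Longrightarrow> next_position D (l, left_width D l, Up) (Suc l, left_width D l + 1, Up)"
| crossing_left: "l < length D \<Longrightarrow> elem_at D l \<in> {Pos, Neg}
    \<Longrightarrow> next_position D (l, left_width D l + 1, Up) (Suc l, left_width D l, Up)"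
| cap_right: "l < length D \<Longrightarrow> elem_at D l = CapLR
    \<Longrightarrow> next_position D (l, left_width D l, Up) (l, left_width D l + 1, Down)"
| cap_left: "l < length D \<Longrightarrow> elem_at D l = CapRL
    \<Longrightarrow> next_position D (l, left_width D l + 1, Up) (l, left_width D l, Down)"
| cup_right: "l < length D \<Longrightarrow> elem_at D l = CupLR
    \<Longrightarrow> next_position D (Suc l, left_width D l, Down) (Suc l, left_width D l + 1, Up)"
| cup_left: "l < length D \<Longrightarrow> elem_at D l = CupRL
    \<Longrightarrow> next_position D (Suc l, left_width D l + 1, Down) (Suc l, left_width D l, Up)"

lemma step_next_position: "next_position D st st' \<Longrightarrow> step D st = st'"
  by (induction rule: next_position.induct) (auto simp: Let_def)

text \<open>Moves backwards along the strand; it serves to show that a position has at most one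
  predecessor.\<close>

fun unstep :: "diagram \<Rightarrow> position \<Rightarrow> position" where
  "unstep D (l, x, Down) =
     (let e = elem_at D l; p = left_width D l in
        if x < p then (Suc l, x, Down)
        else if x < p + length (lower e) then (l, p + (1 - (x - p)), Up)
        else (Suc l, x - length (lower e) + length (upper e), Down))"
| "unstep D (l, x, Up) =
     (let e = elem_at D (l - 1); p = left_width D (l - 1) in
        if x < p then (l - 1, x, Up)
        else if x < p + length (upper e) then
          (if lower e = [] then (l, p + (1 - (x - p)), Down) else (l - 1, p + (1 - (x - p)), Up))
        else (l - 1, x - length (upper e) + length (lower e), Up))"

lemma unstep_next_position: "next_position D st st' \<Longrightarrow> unstep D st' = st"
  by (induction rule: next_position.induct) (auto simp: Let_def)

lemma next_position_inj: "next_position D a c \<Longrightarrow> next_position D b c \<Longrightarrow> a = b"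
  by (metis unstep_next_position)

definition position :: "diagram \<Rightarrow> position \<Rightarrow> bool" where
  "position D = (\<lambda>(l, x, d). l \<le> length D \<and> x < length (level_word D l) \<and> level_word D l ! x = d)"

section \<open>Traversal of a knot diagram\<close>

locale knot =
  fixes D :: diagram
  assumes knot_diagram: "knot_diagram D"
begin

lemma level_word_0 [simp]: "level_word D 0 = [Up]"
  using knot_diagram by (auto simp: knot_diagram_def dest: tangle_level_word)

lemma level_word_length [simp]: "level_word D (length D) = [Up]"
  by (simp add: level_word_def)

lemma level_word_lower:
  "l < length D \<Longrightarrow> level_word D l = fst (D ! l) @ lower (elem_at D l) @ snd (snd (D ! l))"
  by (simp add: level_word_def)

lemma level_word_upper:
  "l < length D \<Longrightarrow> level_word D (Suc l) = fst (D ! l) @ upper (elem_at D l) @ snd (snd (D ! l))"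
  using knot_diagram by (auto simp: knot_diagram_def dest: tangle_level_word)

lemma next_position_positions:
  assumes "next_position D st st'"
  shows "position D st" "position D st'"
proof -
  have "position D st \<and> position D st'"
    using assms
    by (induction rule: next_position.induct)
       (auto simp: position_def level_word_lower level_word_upper left_width_def nth_append)
  then show "position D st" "position D st'" by simp_all
qed

lemma next_position_step:
  assumes "position D st" "fst st < length D \<or> snd (snd st) = Down"
  shows "next_position D st (step D st)"
proof -
  obtain l x d where st: "st = (l, x, d)" by (cases st)
  have "\<exists>st'. next_position D st st'"
  proof (cases d)
    case Up
    then have l: "l < length D" using assms st by simp
    then have x: "x < length (level_word D l)" "level_word D l ! x = Up"
      using assms(1) Up by (auto simp: st position_def)
    consider "x < left_width D l" | "x \<ge> left_width D l" "x < left_width D l + length (lower (elem_at D l))"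
      | y where "x = left_width D l + length (lower (elem_at D l)) + y"
      by (metis le_iff_add not_less)
    then show ?thesis
    proof cases
      case 1
      then show ?thesis using left_up[OF l, of x] x Up l st
        by (auto simp: level_word_lower left_width_def nth_append)
    next
      case 2
      have lx: "lower (elem_at D l) ! (x - left_width D l) = Up"
        using x 2 l by (simp add: level_word_lower left_width_def nth_append split: if_splits)
      have "x = left_width D l \<or> x = left_width D l + 1" using 2 by (cases "elem_at D l") auto
      then show ?thesis
        using 2 lx st Up crossing_right[OF l] crossing_left[OF l] cap_right[OF l] cap_left[OF l]
        by (cases "elem_at D l") auto
    next
      case 3
      then show ?thesis using right_up[OF l, of y] x Up l st
        by (auto simp: level_word_lower left_width_def nth_append)
    qed
  next
    case Down
    \<comment> \<open>The bottom level is \<open>[Up]\<close>, so a downward position has a layer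
      below it.\<close>
    have "l \<noteq> 0" using assms(1) Down by (cases l) (auto simp: st position_def)
    then obtain k where k: "l = Suc k" by (cases l) auto
    then have l: "k < length D" using assms st by (simp add: position_def)
    then have x: "x < length (level_word D (Suc k))" "level_word D (Suc k) ! x = Down"
      using assms(1) Down k by (auto simp: st position_def)
    consider "x < left_width D k" | "x \<ge> left_width D k" "x < left_width D k + length (upper (elem_at D k))"
      | y where "x = left_width D k + length (upper (elem_at D k)) + y"
      by (metis le_iff_add not_less)
    then show ?thesis
    proof cases
      case 1
      then show ?thesis using left_down[OF l, of x] x Down l st k
        by (auto simp: level_word_upper left_width_def nth_append)
    next
      case 2
      have lx: "upper (elem_at D k) ! (x - left_width D k) = Down"
        using x 2 l by (simp add: level_word_upper left_width_def nth_append split: if_splits)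
      have "x = left_width D k \<or> x = left_width D k + 1" using 2 by (cases "elem_at D k") auto
      then show ?thesis using 2 lx st Down k cup_right[OF l] cup_left[OF l]
        by (cases "elem_at D k") auto
    next
      case 3
      then show ?thesis using right_down[OF l, of y] x Down l st k
        by (auto simp: level_word_upper left_width_def nth_append)
    qed
  qed
  then obtain st' where "next_position D st st'" by blast
  then show ?thesis using step_next_position[of D st st'] by simp
qed

lemma visit_Suc: "visit D (Suc m) = step D (visit D m)"
  by (simp add: visit_def)

lemma visit_0 [simp]: "visit D 0 = (0, 0, Up)"
  by (simp add: visit_def)

lemma position_visit:
  assumes "\<And>j. j < m \<Longrightarrow> fst (visit D j) \<noteq> length D"
  shows "position D (visit D m)"
  using assms
proof (induction m)
  case 0
  then show ?case by (simp add: position_def)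
next
  case (Suc m)
  then have v: "position D (visit D m)" "fst (visit D m) \<noteq> length D" by auto
  then have "fst (visit D m) < length D" by (auto simp: position_def split: prod.splits)
  then show ?case using next_position_step[OF v(1)] next_position_positions by (auto simp: visit_Suc)
qed

lemma next_visit:
  assumes "\<And>j. j \<le> m \<Longrightarrow> fst (visit D j) \<noteq> length D"
  shows "next_position D (visit D m) (visit D (Suc m))"
proof -
  have "position D (visit D m)" using assms by (intro position_visit) auto
  moreover from this have "fst (visit D m) < length D"
    using assms[of m] by (auto simp: position_def split: prod.splits)
  ultimately show ?thesis by (auto simp: visit_Suc intro: next_position_step)
qed

text \<open>Equal visits have equal predecessors, so a coincidence can be traced back to the start,
  and no move ends at the bottom endpoint.\<close>

lemma visit_inj:
  assumes "\<And>m. m < K \<Longrightarrow> next_position D (visit D m) (visit D (Suc m))"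
    and "visit D i = visit D j" "i \<le> j" "j \<le> K"
  shows "i = j"
  using assms(2-)
proof (induction i arbitrary: j)
  case 0
  show ?case
  proof (cases j)
    case (Suc k)
    then have "next_position D (visit D k) (0, 0, Up)"
      using assms(1)[of k] 0 by simp
    then show ?thesis by cases
  qed simp
next
  case (Suc i)
  then obtain k where k: "j = Suc k" by (cases j) auto
  then have "visit D i = visit D k"
    using assms(1)[of i] assms(1)[of k] Suc.prems by (auto intro: next_position_inj)
  then show ?case using Suc.IH[of k] Suc.prems k by simp
qed

text \<open>A strand that never reached the top would visit infinitely many distinct positions, but
  there are finitely many. This gives \<open>strand_length\<close>, a \<open>LEAST\<close>, its
  meaning.\<close>

lemma strand_ends: "\<exists>m. fst (visit D m) = length D"
proof (rule ccontr)
  assume "\<not> ?thesis"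
  then have n: "fst (visit D m) \<noteq> length D" for m by blast
  have "visit D i \<noteq> visit D j" if "i < j" for i j
    using visit_inj[OF next_visit, of j i j] n that by auto
  then have inj: "inj (visit D)"
    by (intro injI) (metis linorder_neqE_nat)
  let ?S = "SIGMA l:{..length D}. {..<length (level_word D l)} \<times> {Up, Down}"
  have "visit D m \<in> ?S" for m
  proof -
    obtain l x d where "visit D m = (l, x, d)" by (cases "visit D m")
    moreover have "position D (visit D m)" using n by (intro position_visit)
    moreover have "d \<in> {Up, Down}" by (cases d) auto
    ultimately show ?thesis by (simp add: position_def)
  qed
  then have "range (visit D) \<subseteq> ?S" by (rule image_subsetI)
  moreover have "finite ?S" by simp
  ultimately have "finite (range (visit D))" by (rule finite_subset)
  then show False using finite_imageD[OF _ inj] by simp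
qed

abbreviation M :: nat where "M \<equiv> strand_length D"

lemma fst_visit_M: "fst (visit D M) = length D"
  unfolding strand_length_def using strand_ends by (rule LeastI_ex)

lemma fst_visit_less: "m < M \<Longrightarrow> fst (visit D m) \<noteq> length D"
  unfolding strand_length_def by (rule not_less_Least)

lemma next_visit_less: "m < M \<Longrightarrow> next_position D (visit D m) (visit D (Suc m))"
  by (rule next_visit) (simp add: fst_visit_less)

lemma position_visit_le: "m \<le> M \<Longrightarrow> position D (visit D m)"
  by (rule position_visit) (simp add: fst_visit_less)

lemma visit_M: "visit D M = (length D, 0, Up)"
  using position_visit_le[of M] fst_visit_M by (auto simp: position_def split: prod.splits)

lemma visit_eq_imp: "visit D i = visit D j \<Longrightarrow> i \<le> M \<Longrightarrow> j \<le> M \<Longrightarrow> i = j"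
  using visit_inj[OF next_visit_less, of M i j] visit_inj[OF next_visit_less, of M j i]
  by (cases "i \<le> j") auto

text \<open>Being a single component yields a visit at the right place, and the word of the level
  determines its direction.\<close>

lemma visit_surj:
  assumes "position D st"
  shows "\<exists>m\<le>M. visit D m = st"
proof -
  obtain l x d where st: "st = (l, x, d)" by (cases st)
  show ?thesis
  proof (cases "l < length D")
    case True
    have "x < left_width D l + length (lower (elem_at D l)) + right_width D l"
      using assms True by (simp add: st position_def level_word_lower left_width_def)
    then obtain m d' where m: "m \<le> M" "visit D m = (l, x, d')"
      using knot_diagram True unfolding knot_diagram_def one_component_def by meson
    then have "d' = d" using position_visit_le[of m] assms by (simp add: st position_def)
    then show ?thesis using m st by blast
  next
    case False
    then show ?thesis using assms visit_M unfolding st by (auto simp: position_def)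
  qed
qed

lemma time_visit: "m \<le> M \<Longrightarrow> time D (visit D m) = m"
  unfolding time_def
proof (rule Least_equality)
  fix j assume "m \<le> M" "visit D j = visit D m"
  \<comment> \<open>Injectivity is known only up to \<open>M\<close>; a later \<open>j\<close>
    exceeds \<open>m\<close> in any case.\<close>
  then show "m \<le> j" using visit_eq_imp[of j m] by (cases "j \<le> M") auto
qed (rule refl)

lemma
  assumes "position D st"
  shows visit_time: "visit D (time D st) = st" and time_le: "time D st \<le> M"
proof -
  obtain m where "m \<le> M" "visit D m = st" using visit_surj[OF assms] by blast
  then show "visit D (time D st) = st" "time D st \<le> M" using time_visit[of m] by auto
qed

lemma time_eq_iff: "position D st \<Longrightarrow> position D st' \<Longrightarrow> time D st = time D st' \<longleftrightarrow> st = st'"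
  by (metis visit_time)

lemma time_start [simp]: "time D (0, 0, Up) = 0"
  using time_visit[of 0] by simp

lemma time_end [simp]: "time D (length D, 0, Up) = M"
  using time_visit[of M] by (simp add: visit_M)

lemma next_position_time:
  assumes "next_position D st st'"
  shows "time D st' = Suc (time D st)" "time D st < M"
proof -
  have v: "position D st" "position D st'" using assms by (rule next_position_positions)+
  have "st \<noteq> (length D, 0, Up)" using assms by cases auto
  then show *: "time D st < M"
    using visit_time[OF v(1)] visit_M time_le[OF v(1)] by (metis le_neq_implies_less)
  have "visit D (Suc (time D st)) = st'"
    using visit_time[OF v(1)] step_next_position[OF assms] by (simp add: visit_Suc)
  then show "time D st' = Suc (time D st)" using time_visit[of "Suc (time D st)"] * by simp
qed

section \<open>Labels\<close>

definition over_position :: "nat \<Rightarrow> position" where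
  "over_position l = (l, left_width D l + (if elem_at D l = Pos then 0 else 1), Up)"

definition under_position :: "nat \<Rightarrow> position" where
  "under_position l = (l, left_width D l + (if elem_at D l = Pos then 1 else 0), Up)"

definition is_crossing :: "nat \<Rightarrow> bool" where
  "is_crossing l \<longleftrightarrow> l < length D \<and> elem_at D l \<in> {Pos, Neg}"

lemma set_crossings: "set (crossings D) = {l. is_crossing l}"
  by (auto simp: crossings_def is_crossing_def)

lemma distinct_crossings: "distinct (crossings D)"
  by (simp add: crossings_def)

lemma crossing_positions:
  assumes "is_crossing l"
  shows "position D (over_position l)" "position D (under_position l)"
    and "time D (over_position l) < M" "time D (under_position l) < M"
  using assms crossing_right[of l D] crossing_left[of l D]
  by (auto simp: is_crossing_def over_position_def under_position_def
      dest: next_position_positions next_position_time)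

definition label_change :: "(nat \<Rightarrow> nat) \<Rightarrow> position \<Rightarrow> int" where
  "label_change J st = (if is_crossing (fst st) then
     int (J (fst st)) * (of_bool (st = under_position (fst st)) - of_bool (st = over_position (fst st))) else 0)"

text \<open>Multi-indices are numbered by crossings, levels by layers. Writing the list as
  \<open>map J (crossings D)\<close> replaces crossing numbers by layers from here on.\<close>

lemma label_map:
  "label D (map J (crossings D)) m = (\<Sum>l | is_crossing l. int (J l) *
     (of_bool (time D (under_position l) < m) - of_bool (time D (over_position l) < m)))"
proof -
  let ?f = "\<lambda>l. int (J l) *
     (of_bool (time D (under_position l) < m) - of_bool (time D (over_position l) < m))"
  have "label D (map J (crossings D)) m = (\<Sum>k<length (crossings D). ?f (crossings D ! k))"
    by (simp add: label_def under_time_def over_time_def under_position_def over_position_def)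
  also have "\<dots> = sum_list (map ?f (crossings D))"
    by (simp add: sum_list_sum_nth lessThan_atLeast0)
  finally show ?thesis
    by (simp add: sum_list_distinct_conv_sum_set distinct_crossings set_crossings)
qed

lemma finite_crossings [simp]: "finite {l. is_crossing l}"
  by (simp add: set_crossings[symmetric])

lemma label_0: "label D i 0 = 0"
  by (simp add: label_def)

text \<open>By time \<open>M\<close> every crossing has been passed once above and once below, and
  the two contributions cancel.\<close>

lemma label_M: "label D (map J (crossings D)) M = 0"
  unfolding label_map by (intro sum.neutral) (auto simp: crossing_positions)

text \<open>\<open>label\<close> counts passes strictly before the given time, so a move adds just
  the pass at its starting position; injectivity of \<open>time\<close> singles out the
  crossing.\<close>

lemma label_next:
  assumes "next_position D st st'"
  shows "label D (map J (crossings D)) (time D st') =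
    label D (map J (crossings D)) (time D st) + label_change J st"
proof -
  have st: "position D st" using assms by (rule next_position_positions)
  have lt: "of_bool (u < Suc t) = (of_bool (u < t) + of_bool (u = t) :: int)" for u t :: nat
    by auto
  have "label D (map J (crossings D)) (time D st') - label D (map J (crossings D)) (time D st)
      = (\<Sum>l | is_crossing l. int (J l) * (of_bool (time D (under_position l) = time D st)
          - of_bool (time D (over_position l) = time D st)))"
    unfolding label_map next_position_time(1)[OF assms] lt sum_subtractf[symmetric]
    by (intro sum.cong refl) (simp add: algebra_simps)
  also have "\<dots> = (\<Sum>l | is_crossing l. if l = fst st then label_change J st else 0)"
    by (intro sum.cong refl)
       (auto simp: time_eq_iff crossing_positions st label_change_def, auto simp: over_position_def under_position_def)
  also have "\<dots> = label_change J st"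
    by (simp add: label_change_def)
  finally show ?thesis by simp
qed

end

section \<open>Labelings of the levels and multi-indices\<close>

definition flow :: "diagram \<Rightarrow> nat \<Rightarrow> nat \<Rightarrow> nat list \<Rightarrow> nat list \<Rightarrow> bool" where
  "flow D l m w w' \<longleftrightarrow> (let p = left_width D l in
     (\<forall>x<p. w ! x = w' ! x) \<and>
     (\<forall>y<right_width D l. w ! (p + length (lower (elem_at D l)) + y)
        = w' ! (p + length (upper (elem_at D l)) + y)) \<and>
     (case elem_at D l of
        Pos \<Rightarrow> w ! p = w' ! (p + 1) + m \<and> w' ! p = w ! (p + 1) + m
      | Neg \<Rightarrow> w ! (p + 1) = w' ! p + m \<and> w' ! (p + 1) = w ! p + m
      | CapLR \<Rightarrow> w ! p = w ! (p + 1)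
      | CapRL \<Rightarrow> w ! p = w ! (p + 1)
      | CupLR \<Rightarrow> w' ! p = w' ! (p + 1)
      | CupRL \<Rightarrow> w' ! p = w' ! (p + 1)))"

text \<open>At a crossing this is the drop of the label of the over-strand, by which
  \<open>i_k\<close> is recovered from the labels. If the label rises, truncation gives
  \<open>0\<close> and \<open>flow\<close> with this value fails.\<close>

definition jump :: "diagram \<Rightarrow> nat \<Rightarrow> nat list \<Rightarrow> nat list \<Rightarrow> nat" where
  "jump D l w w' = (let p = left_width D l in
     if elem_at D l = Pos then w ! p - w' ! (p + 1) else w ! (p + 1) - w' ! p)"

lemma flow_jump:
  assumes "flow D l m w w'"
  shows "flow D l (jump D l w w') w w'" "elem_at D l \<in> {Pos, Neg} \<Longrightarrow> jump D l w w' = m"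
  using assms by (cases "elem_at D l"; auto simp: flow_def jump_def Let_def)+

context generic_q
begin

definition local_weight :: "diagram \<Rightarrow> nat \<Rightarrow> nat \<Rightarrow> nat list \<Rightarrow> nat list \<Rightarrow> 'a" where
  "local_weight D n l w w' = (let p = left_width D l; m = jump D l w w' in
     case elem_at D l of
       Pos \<Rightarrow> pos_weight n (w ! (p + 1)) (w ! p) m
     | Neg \<Rightarrow> neg_weight n (w ! p) (w ! (p + 1)) m
     | CapLR \<Rightarrow> s powi (2 * weight n (w ! p))
     | CupLR \<Rightarrow> s powi (- 2 * weight n (w' ! p))
     | _ \<Rightarrow> 1)"

lemma elem_mat_entry:
  assumes "b \<in> label_words (n + 1) (length (lower e))" "b' \<in> label_words (n + 1) (length (upper e))"
  shows "elem_mat s n e $$ (enc (n + 1) b', enc (n + 1) b) = (case e of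
       Pos \<Rightarrow> let m = b ! 0 - b' ! 1 in
         if b ! 0 = b' ! 1 + m \<and> b' ! 0 = b ! 1 + m then pos_weight n (b ! 1) (b ! 0) m else 0
     | Neg \<Rightarrow> let m = b ! 1 - b' ! 0 in
         if b ! 1 = b' ! 0 + m \<and> b' ! 1 = b ! 0 + m then neg_weight n (b ! 0) (b ! 1) m else 0
     | CapLR \<Rightarrow> if b ! 0 = b ! 1 then s powi (2 * weight n (b ! 0)) else 0
     | CapRL \<Rightarrow> if b ! 0 = b ! 1 then 1 else 0
     | CupLR \<Rightarrow> if b' ! 0 = b' ! 1 then s powi (- 2 * weight n (b' ! 0)) else 0
     | CupRL \<Rightarrow> if b' ! 0 = b' ! 1 then 1 else 0)"
proof -
  define d where "d = n + 1"
  have pair: "\<exists>x y. w = [x, y] \<and> x \<le> n \<and> y \<le> n" if "w \<in> label_words (Suc n) (Suc (Suc 0))" for w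
    using that by (auto simp: label_words_def length_Suc_conv)
  have lt: "x * d + y < d * d" and dm: "(x * d + y) div d = x" "(x * d + y) mod d = y"
    if "x \<le> n" "y \<le> n" for x y
  proof -
    have "x < d" "y < d" using that by (simp_all add: d_def)
    then show "x * d + y < d * d" "(x * d + y) div d = x" "(x * d + y) mod d = y"
      by (simp_all add: digit_less)
  qed
  have enc_2: "enc d [x, y] = x * d + y" for x y
    by simp
  show ?thesis
  proof (cases e)
    case Pos
    obtain x y x' y' where b: "b = [x, y]" "x \<le> n" "y \<le> n" "b' = [x', y']" "x' \<le> n" "y' \<le> n"
      using pair[of b] pair[of b'] assms Pos by auto
    show ?thesis using braiding_entry[OF b(2,3,5,6)]
      by (auto simp: Pos b pos_weight_def Let_def)
  next
    case Neg
    obtain x y x' y' where b: "b = [x, y]" "x \<le> n" "y \<le> n" "b' = [x', y']" "x' \<le> n" "y' \<le> n"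
      using pair[of b] pair[of b'] assms Neg by auto
    show ?thesis using neg_braiding_entry[OF b(2,3,5,6)]
      by (auto simp: Neg b neg_weight_def Let_def braiding_inv_eq)
  next
    case CapLR
    obtain x y where b: "b = [x, y]" "x \<le> n" "y \<le> n"
      using pair[of b] assms CapLR by auto
    have nil: "b' = []" using assms CapLR by (simp add: label_words_def)
    show ?thesis using lt[OF b(2,3)] dm[OF b(2,3)]
      unfolding CapLR b(1) nil elem_mat.simps elem.case d_def[symmetric] enc_2 enc.simps(1) by simp
  next
    case CapRL
    obtain x y where b: "b = [x, y]" "x \<le> n" "y \<le> n"
      using pair[of b] assms CapRL by auto
    have nil: "b' = []" using assms CapRL by (simp add: label_words_def)
    show ?thesis using lt[OF b(2,3)] dm[OF b(2,3)]
      unfolding CapRL b(1) nil elem_mat.simps elem.case d_def[symmetric] enc_2 enc.simps(1) by simp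
  next
    case CupLR
    obtain x y where b: "b' = [x, y]" "x \<le> n" "y \<le> n"
      using pair[of b'] assms CupLR by auto
    have nil: "b = []" using assms CupLR by (simp add: label_words_def)
    show ?thesis using lt[OF b(2,3)] dm[OF b(2,3)]
      unfolding CupLR b(1) nil elem_mat.simps elem.case d_def[symmetric] enc_2 enc.simps(1) by simp
  next
    case CupRL
    obtain x y where b: "b' = [x, y]" "x \<le> n" "y \<le> n"
      using pair[of b'] assms CupRL by auto
    have nil: "b = []" using assms CupRL by (simp add: label_words_def)
    show ?thesis using lt[OF b(2,3)] dm[OF b(2,3)]
      unfolding CupRL b(1) nil elem_mat.simps elem.case d_def[symmetric] enc_2 enc.simps(1) by simp
  qed
qed

text \<open>The identity matrices beside the elementary piece force equal labels there, and the
  piece itself conserves labels up to the transfer at a crossing; all other entries vanish.\<close>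

lemma layer_entry_flow:
  assumes "w \<in> label_words (n + 1) (length (lower_word (D ! l)))"
    and "w' \<in> label_words (n + 1) (length (upper_word (D ! l)))"
  shows "layer_entry s n (D ! l) w w' =
    (if flow D l (jump D l w w') w w' then local_weight D n l w w' else 0)"
proof -
  obtain u e v where L: "D ! l = (u, e, v)" by (cases "D ! l")
  have e: "elem_at D l = e" and p: "left_width D l = length u" and r: "right_width D l = length v"
    by (simp_all add: elem_at_def left_width_def L)
  let ?p = "length u" and ?k = "length (lower e)" and ?k' = "length (upper e)" and ?r = "length v"
  define a b c a' b' c' where "a = take ?p w" "b = take ?k (drop ?p w)" "c = drop (?p + ?k) w"
    and "a' = take ?p w'" "b' = take ?k' (drop ?p w')" "c' = drop (?p + ?k') w'"
  note defs = this
  have w: "w = a @ b @ c" and w': "w' = a' @ b' @ c'"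
    unfolding defs by (metis add.commute append_take_drop_id drop_drop)+
  have len: "length w = ?p + (?k + ?r)" "length w' = ?p + (?k' + ?r)"
    using assms by (auto simp: label_words_def L lower_word_def upper_word_def)
  have lens: "length a = ?p" "length a' = ?p" "length b = ?k" "length b' = ?k'" "length c = ?r" "length c' = ?r"
    using len by (auto simp: defs)
  have bw: "b \<in> label_words (n + 1) ?k" "b' \<in> label_words (n + 1) ?k'"
    using assms lens unfolding w w' label_words_def by auto
  have left: "(\<forall>x<?p. w ! x = w' ! x) \<longleftrightarrow> a = a'"
    unfolding w w' list_eq_iff_nth_eq[of a a'] by (auto simp: nth_append lens)
  have right: "(\<forall>y<?r. w ! (?p + ?k + y) = w' ! (?p + ?k' + y)) \<longleftrightarrow> c = c'"
    unfolding w w' list_eq_iff_nth_eq[of c c'] by (auto simp: nth_append lens)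
  have mid: "i < ?k \<Longrightarrow> w ! (?p + i) = b ! i" "i < ?k' \<Longrightarrow> w' ! (?p + i) = b' ! i" for i
    unfolding w w' by (simp_all add: nth_append lens)
  have "layer_entry s n (D ! l) w w' =
      of_bool (a = a' \<and> c = c') * elem_mat s n e $$ (enc (n + 1) b', enc (n + 1) b)"
    unfolding layer_entry_def L prod.case Let_def defs by (rule refl)
  then show ?thesis
    unfolding elem_mat_entry[OF bw] flow_def local_weight_def jump_def e p r Let_def left right
    using mid[of 0] mid[of 1] by (cases e) auto
qed

end

context knot
begin

text \<open>Each clause of \<open>flow\<close> is the equation for a rule of
  \<open>next_position\<close>. This converts the layerwise condition coming from the matrix product
  into one along the strand.\<close>

lemma flow_iff:
  "(\<forall>l<length D. flow D l (J l) (cs ! l) (cs ! Suc l)) \<longleftrightarrow>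
   (\<forall>l x d l' x' d'. next_position D (l, x, d) (l', x', d') \<longrightarrow>
      int (cs ! l' ! x') = int (cs ! l ! x) + label_change J (l, x, d))"
  (is "?flow \<longleftrightarrow> ?next")
proof
  assume flow: ?flow
  show ?next
  proof (intro allI impI)
    fix l x d l' x' d' assume "next_position D (l, x, d) (l', x', d')"
    then show "int (cs ! l' ! x') = int (cs ! l ! x) + label_change J (l, x, d)"
      by cases (use flow in \<open>auto simp: flow_def Let_def label_change_def is_crossing_def
          over_position_def under_position_def\<close>)
  qed
next
  assume "?next"
  then have nxt: "int (cs ! l' ! x') = int (cs ! l ! x) + label_change J (l, x, d)"
    if "next_position D (l, x, d) (l', x', d')" for l x d l' x' d'
    using that by blast
  show ?flow
  proof (intro allI impI)
    fix l assume l: "l < length D"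
    let ?p = "left_width D l"
    have left: "cs ! l ! x = cs ! Suc l ! x" if x: "x < ?p" for x
    proof (cases "fst (D ! l) ! x")
      case Up
      with nxt[OF left_up[OF l x]] x show ?thesis
        by (auto simp: label_change_def over_position_def under_position_def split: if_splits)
    next
      case Down
      with nxt[OF left_down[OF l x]] show ?thesis
        by (auto simp: label_change_def over_position_def under_position_def split: if_splits)
    qed
    have right: "cs ! l ! (?p + length (lower (elem_at D l)) + y)
        = cs ! Suc l ! (?p + length (upper (elem_at D l)) + y)" if y: "y < right_width D l" for y
    proof (cases "snd (snd (D ! l)) ! y")
      case Up
      with nxt[OF right_up[OF l y]] show ?thesis
        by (auto simp: label_change_def over_position_def under_position_def is_crossing_def split: if_splits)
    next
      case Down
      with nxt[OF right_down[OF l y]] show ?thesis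
        by (auto simp: label_change_def over_position_def under_position_def split: if_splits)
    qed
    note defs = label_change_def over_position_def under_position_def is_crossing_def
    have "case elem_at D l of
        Pos \<Rightarrow> cs ! l ! ?p = cs ! Suc l ! (?p + 1) + J l \<and> cs ! Suc l ! ?p = cs ! l ! (?p + 1) + J l
      | Neg \<Rightarrow> cs ! l ! (?p + 1) = cs ! Suc l ! ?p + J l \<and> cs ! Suc l ! (?p + 1) = cs ! l ! ?p + J l
      | CapLR \<Rightarrow> cs ! l ! ?p = cs ! l ! (?p + 1)
      | CapRL \<Rightarrow> cs ! l ! ?p = cs ! l ! (?p + 1)
      | CupLR \<Rightarrow> cs ! Suc l ! ?p = cs ! Suc l ! (?p + 1)
      | CupRL \<Rightarrow> cs ! Suc l ! ?p = cs ! Suc l ! (?p + 1)"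
    proof (cases "elem_at D l")
      case Pos
      then show ?thesis using nxt[OF crossing_right[OF l]] nxt[OF crossing_left[OF l]] l
        by (simp add: defs)
    next
      case Neg
      then show ?thesis using nxt[OF crossing_right[OF l]] nxt[OF crossing_left[OF l]] l
        by (simp add: defs)
    next
      case CapLR
      then show ?thesis using nxt[OF cap_right[OF l]] by (simp add: defs)
    next
      case CapRL
      then show ?thesis using nxt[OF cap_left[OF l]] by (simp add: defs)
    next
      case CupLR
      then show ?thesis using nxt[OF cup_right[OF l]] by (simp add: defs split: if_splits)
    next
      case CupRL
      then show ?thesis using nxt[OF cup_left[OF l]] by (simp add: defs split: if_splits)
    qed
    then show "flow D l (J l) (cs ! l) (cs ! Suc l)"
      unfolding flow_def Let_def using left right by blast
  qed
qed

end

lemma (in generic_q) prod_powi: "finite S \<Longrightarrow> (\<Prod>l\<in>S. s powi f l) = s powi (\<Sum>l\<in>S. f l)"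
  by (induction S rule: finite_induct) (simp_all add: power_int_add)

section \<open>Level labelings correspond to bounded multi-indices\<close>

locale knot_sum = knot D + generic_q s
  for D :: diagram and s :: "'a::field"
begin

definition label_bounded :: "nat \<Rightarrow> nat list set" where
  "label_bounded n = {map J (crossings D) | J.
     \<forall>t \<le> M. 0 \<le> label D (map J (crossings D)) t \<and> label D (map J (crossings D)) t \<le> int n}"

definition flows :: "nat \<Rightarrow> nat list list set" where
  "flows n = {cs \<in> label_paths n D [0].
     \<forall>l<length D. flow D l (jump D l (cs ! l) (cs ! Suc l)) (cs ! l) (cs ! Suc l)}"

definition flow_jumps :: "nat list list \<Rightarrow> nat list" where
  "flow_jumps cs = map (\<lambda>l. jump D l (cs ! l) (cs ! Suc l)) (crossings D)"

text \<open>The inverse of \<open>flow_jumps\<close> on bounded multi-indices, where all labels are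
  nonnegative and \<open>nat\<close> loses nothing.\<close>

definition labeling :: "nat list \<Rightarrow> nat list list" where
  "labeling i = map (\<lambda>l. map (\<lambda>x. nat (label D i (time D (l, x, level_word D l ! x))))
     [0..<length (level_word D l)]) [0..<Suc (length D)]"

lemma layer_words:
  assumes "l < length D"
  shows "lower_word (D ! l) = level_word D l" "upper_word (D ! l) = level_word D (Suc l)"
  using assms by (cases "D ! l"; simp add: lower_word_def upper_word_def level_word_lower level_word_upper elem_at_def)+

lemma path_words:
  "cs \<in> label_paths n D [0] \<longleftrightarrow> length cs = Suc (length D) \<and> cs ! 0 = [0] \<and> cs ! length D = [0] \<and>
     (\<forall>l \<le> length D. cs ! l \<in> label_words (n + 1) (length (level_word D l)))"
proof -
  have split: "(\<forall>l \<le> length D. Q l) \<longleftrightarrow> Q 0 \<and> (\<forall>l < length D. Q (Suc l))" for Q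
    unfolding less_Suc_eq_le[symmetric] by (rule All_less_Suc2)
  have upper: "(\<forall>l < length D. cs ! Suc l \<in> label_words (n + 1) (length (upper_word (D ! l)))) \<longleftrightarrow>
      (\<forall>l < length D. cs ! Suc l \<in> label_words (n + 1) (length (level_word D (Suc l))))"
    by (metis layer_words(2))
  have "[0] \<in> label_words (n + 1) (length (level_word D 0))"
    by (simp add: label_words_def)
  then show ?thesis unfolding label_paths_iff upper split by metis
qed

text \<open>Both sides are \<open>0\<close> at the bottom and change alike under every move, so they
  agree along the strand, which meets every position.\<close>

lemma label_flow_jumps:
  assumes "cs \<in> flows n" "position D (l, x, d)"
  shows "label D (flow_jumps cs) (time D (l, x, d)) = int (cs ! l ! x)"
proof -
  define J where "J l = jump D l (cs ! l) (cs ! Suc l)" for l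
  have i: "flow_jumps cs = map J (crossings D)" by (simp add: flow_jumps_def J_def)
  have "\<forall>l<length D. flow D l (J l) (cs ! l) (cs ! Suc l)"
    using assms(1) by (simp add: flows_def J_def)
  note flow = this[unfolded flow_iff]
  have "\<forall>l x d. visit D t = (l, x, d) \<longrightarrow> label D (map J (crossings D)) t = int (cs ! l ! x)"
    if "t \<le> M" for t
    using that
  proof (induction t)
    case 0
    then show ?case using assms(1) by (auto simp: label_0 flows_def label_paths_iff)
  next
    case (Suc t)
    obtain l x d l' x' d' where st: "visit D t = (l, x, d)" "visit D (Suc t) = (l', x', d')"
      by (metis prod_cases3)
    then have n: "next_position D (l, x, d) (l', x', d')" using next_visit_less[of t] Suc.prems by simp
    have "time D (l, x, d) = t" "time D (l', x', d') = Suc t"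
      using time_visit[of t] time_visit[of "Suc t"] st Suc.prems by simp_all
    then have "label D (map J (crossings D)) (Suc t) = int (cs ! l ! x) + label_change J (l, x, d)"
      using label_next[OF n, of J] Suc st by simp
    also have "\<dots> = int (cs ! l' ! x')" using flow[rule_format, OF n] by simp
    finally show ?case using st by simp
  qed
  from this[OF time_le[OF assms(2)]] show ?thesis
    by (simp add: i visit_time[OF assms(2)])
qed

lemma labeling_nth:
  assumes "position D (l, x, d)"
  shows "labeling i ! l ! x = nat (label D i (time D (l, x, d)))"
  using assms unfolding labeling_def position_def by (simp add: less_Suc_eq_le del: upt_Suc)

lemma labeling_flow_jumps:
  assumes "cs \<in> flows n"
  shows "labeling (flow_jumps cs) = cs" "flow_jumps cs \<in> label_bounded n"
proof -
  have cs: "length cs = Suc (length D)"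
    and words: "\<And>l. l \<le> length D \<Longrightarrow> cs ! l \<in> label_words (n + 1) (length (level_word D l))"
    using assms by (auto simp: flows_def path_words)
  then have len: "\<And>l. l \<le> length D \<Longrightarrow> length (cs ! l) = length (level_word D l)"
    by (auto simp: label_words_def)
  have pos: "position D (l, x, level_word D l ! x)" if "l \<le> length D" "x < length (level_word D l)" for l x
    using that by (simp add: position_def)
  show "labeling (flow_jumps cs) = cs"
  proof (rule nth_equalityI)
    show "length (labeling (flow_jumps cs)) = length cs" by (simp add: labeling_def cs)
    fix l assume "l < length (labeling (flow_jumps cs))"
    then have l: "l \<le> length D" by (simp add: labeling_def)
    have ll: "length (labeling (flow_jumps cs) ! l) = length (level_word D l)"
      using l by (simp add: labeling_def less_Suc_eq_le del: upt_Suc)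
    show "labeling (flow_jumps cs) ! l = cs ! l"
    proof (rule nth_equalityI)
      fix x assume "x < length (labeling (flow_jumps cs) ! l)"
      then have "x < length (level_word D l)" using ll by simp
      then show "labeling (flow_jumps cs) ! l ! x = cs ! l ! x"
        using labeling_nth[OF pos] label_flow_jumps[OF assms pos] l by simp
    qed (simp add: ll len l)
  qed
  have "0 \<le> label D (flow_jumps cs) t \<and> label D (flow_jumps cs) t \<le> int n" if t: "t \<le> M" for t
  proof -
    obtain l x d where st: "visit D t = (l, x, d)" by (metis prod_cases3)
    then have p: "position D (l, x, d)" using position_visit_le[OF t] by simp
    then have "l \<le> length D" "x < length (cs ! l)" by (auto simp: position_def len)
    then have "cs ! l ! x \<in> {..<n + 1}"
      using words[of l] nth_mem[of x "cs ! l"] unfolding label_words_def by blast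
    then have "cs ! l ! x < n + 1" by simp
    then show ?thesis using label_flow_jumps[OF assms p] time_visit[OF t] st by simp
  qed
  then show "flow_jumps cs \<in> label_bounded n" unfolding label_bounded_def flow_jumps_def by blast
qed

text \<open>By \<open>label_next\<close> the labels obey the rule of \<open>flow_iff\<close>. The
  bounds make them admissible basis indices, and \<open>label_0\<close> and \<open>label_M\<close>
  supply the zeros at both ends.\<close>

lemma flow_jumps_labeling:
  assumes "i \<in> label_bounded n"
  shows "flow_jumps (labeling i) = i" "labeling i \<in> flows n"
proof -
  obtain J where i: "i = map J (crossings D)"
    and bound: "\<And>t. t \<le> M \<Longrightarrow> 0 \<le> label D i t \<and> label D i t \<le> int n"
    using assms by (auto simp: label_bounded_def)
  let ?cs = "labeling i"
  have cs: "int (?cs ! l ! x) = label D i (time D (l, x, d))" if "position D (l, x, d)" for l x d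
    using labeling_nth[OF that] bound[OF time_le[OF that]] by simp
  have "\<forall>l<length D. flow D l (J l) (?cs ! l) (?cs ! Suc l)"
    unfolding flow_iff
  proof (intro allI impI)
    fix l x d l' x' d' assume n: "next_position D (l, x, d) (l', x', d')"
    show "int (?cs ! l' ! x') = int (?cs ! l ! x) + label_change J (l, x, d)"
      using cs[OF next_position_positions(1)[OF n]] cs[OF next_position_positions(2)[OF n]]
        label_next[OF n, of J] i by simp
  qed
  then have flow: "flow D l (J l) (?cs ! l) (?cs ! Suc l)" if "l < length D" for l
    using that by blast
  show "flow_jumps (labeling i) = i"
    unfolding flow_jumps_def i[symmetric] using flow_jump(2)[OF flow] set_crossings i
    by (auto simp: is_crossing_def)
  have len: "length ?cs = Suc (length D)" by (simp add: labeling_def)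
  have lens: "length (?cs ! l) = length (level_word D l)" if "l \<le> length D" for l
    using that by (simp add: labeling_def less_Suc_eq_le del: upt_Suc)
  have pos: "position D (l, x, level_word D l ! x)" if "l \<le> length D" "x < length (level_word D l)" for l x
    using that by (simp add: position_def)
  have "?cs ! l \<in> label_words (n + 1) (length (level_word D l))" if l: "l \<le> length D" for l
  proof -
    have "a < n + 1" if a: "a \<in> set (?cs ! l)" for a
    proof -
      obtain x where x: "x < length (level_word D l)" "a = ?cs ! l ! x"
        using a lens[OF l] by (auto simp: in_set_conv_nth)
      then have "int a = label D i (time D (l, x, level_word D l ! x))" using cs[OF pos[OF l x(1)]] by simp
      also have "\<dots> \<le> int n" using bound[OF time_le[OF pos[OF l x(1)]]] by simp
      finally show ?thesis by simp
    qed
    then show ?thesis using lens[OF l] by (auto simp: label_words_def)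
  qed
  moreover have "?cs ! 0 = [0]"
  proof -
    have "?cs ! 0 ! 0 = 0" using cs[OF pos, of 0 0] by (simp add: label_0)
    then show ?thesis using lens[of 0] by (auto simp: length_Suc_conv)
  qed
  moreover have "?cs ! length D = [0]"
  proof -
    have "?cs ! length D ! 0 = 0" using cs[OF pos, of "length D" 0] by (simp add: i label_M)
    then show ?thesis using lens[of "length D"] by (auto simp: length_Suc_conv)
  qed
  ultimately have "?cs \<in> label_paths n D [0]" using len by (simp add: path_words)
  then show "labeling i \<in> flows n" using flow_jump(1)[OF flow] by (auto simp: flows_def)
qed

text \<open>A bounded multi-index is determined by its labeling, and there are finitely many
  paths.\<close>

lemma finite_label_bounded: "finite (label_bounded n)"
proof (rule finite_subset)
  show "label_bounded n \<subseteq> flow_jumps ` label_paths n D [0]"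
  proof
    fix i assume "i \<in> label_bounded n"
    note flow_jumps_labeling[OF this]
    then have "i = flow_jumps (labeling i)" "labeling i \<in> label_paths n D [0]"
      by (simp_all add: flows_def)
    then show "i \<in> flow_jumps ` label_paths n D [0]" by (rule image_eqI)
  qed
qed simp

lemma RT_mat_flows:
  "RT_mat s n D $$ (0, 0) = (\<Sum>cs\<in>flows n. \<Prod>l<length D. local_weight D n l (cs ! l) (cs ! Suc l))"
proof -
  have "tangle D [Up] [Up]" using knot_diagram by (simp add: knot_diagram_def)
  from RT_mat_entry[OF this, of "[0]" n]
  have "RT_mat s n D $$ (0, 0) =
    (\<Sum>cs \<in> label_paths n D [0]. \<Prod>l<length D. layer_entry s n (D ! l) (cs ! l) (cs ! Suc l))"
    by (simp add: label_words_def)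
  also have "\<dots> = (\<Sum>cs \<in> flows n. \<Prod>l<length D. layer_entry s n (D ! l) (cs ! l) (cs ! Suc l))"
  proof (rule sum.mono_neutral_right)
    show "\<forall>cs\<in>label_paths n D [0] - flows n.
        (\<Prod>l<length D. layer_entry s n (D ! l) (cs ! l) (cs ! Suc l)) = 0"
    proof
      fix cs assume cs: "cs \<in> label_paths n D [0] - flows n"
      then obtain l where l: "l < length D" "\<not> flow D l (jump D l (cs ! l) (cs ! Suc l)) (cs ! l) (cs ! Suc l)"
        by (auto simp: flows_def)
      have words: "cs ! l \<in> label_words (n + 1) (length (lower_word (D ! l)))"
        "cs ! Suc l \<in> label_words (n + 1) (length (upper_word (D ! l)))"
        using cs l(1) by (simp_all add: path_words layer_words)
      have "layer_entry s n (D ! l) (cs ! l) (cs ! Suc l) = 0"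
        unfolding layer_entry_flow[OF words] using l(2) by simp
      then show "(\<Prod>l<length D. layer_entry s n (D ! l) (cs ! l) (cs ! Suc l)) = 0"
        using l by auto
    qed
  qed (auto simp: flows_def)
  also have "\<dots> = (\<Sum>cs\<in>flows n. \<Prod>l<length D. local_weight D n l (cs ! l) (cs ! Suc l))"
  proof (intro sum.cong prod.cong refl)
    fix cs l assume cs: "cs \<in> flows n" and "l \<in> {..<length D}"
    then have l: "l < length D" by simp
    have words: "cs ! l \<in> label_words (n + 1) (length (lower_word (D ! l)))"
      "cs ! Suc l \<in> label_words (n + 1) (length (upper_word (D ! l)))"
      using cs l by (simp_all add: flows_def path_words layer_words)
    show "layer_entry s n (D ! l) (cs ! l) (cs ! Suc l) = local_weight D n l (cs ! l) (cs ! Suc l)"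
      unfolding layer_entry_flow[OF words] using cs l by (simp add: flows_def)
  qed
  finally show ?thesis .
qed

end

section \<open>From matrix entries to the terms of the state sum\<close>

context knot_sum
begin

interpretation eval_at: comm_ring_hom "eval_at n" for n
  by (rule eval_at_hom)

definition crossing_term :: "(nat \<Rightarrow> nat) \<Rightarrow> nat \<Rightarrow> qA_ring" where
  "crossing_term J l =
     (let m = J l;
          a = label D (map J (crossings D)) (time D (under_position l));
          b = label D (map J (crossings D)) (time D (over_position l));
          common = Poly_Mapping.single 0 (qbinom (nat a + m) m) * abrace (- a) m
      in if elem_at D l = Pos
         then mon (int m * (int m - 1) div 2) 0 * common * mon 0 (- (a + b))
                * mon (2 * (a + int m) * (b - int m)) 0
         else (- 1) ^ m * mon (- (int m * (int m - 1) div 2)) 0 * common * mon 0 (a + b)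
                * mon (- 2 * a * b) 0)"

text \<open>The matrix product runs over layers and the state term over crossing numbers; filling
  the other layers with \<open>1\<close> makes the two products comparable factor by factor.\<close>

lemma prod_crossing_factor:
  "(\<Prod>k<length (crossings D). crossing_factor D (map J (crossings D)) k) =
     (\<Prod>l<length D. if is_crossing l then crossing_term J l else 1)"
proof -
  have "(\<Prod>k<length (crossings D). crossing_factor D (map J (crossings D)) k)
      = (\<Prod>k<length (crossings D). crossing_term J (crossings D ! k))"
    by (intro prod.cong refl)
       (simp add: crossing_factor_def crossing_term_def Let_def over_time_def under_time_def
          over_position_def under_position_def)
  also have "\<dots> = (\<Prod>l | is_crossing l. crossing_term J l)"
    unfolding set_crossings[symmetric]
    by (rule prod.reindex_bij_betw[OF bij_betw_nth[OF distinct_crossings]]) simp_all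
  also have "\<dots> = (\<Prod>l<length D. if is_crossing l then crossing_term J l else 1)"
    by (rule prod.mono_neutral_cong_left) (auto simp: is_crossing_def)
  finally show ?thesis .
qed

text \<open>In a flow the labels of the multi-index are the entries of the words, so each local
  factor can be compared directly; every crossing leaves over a framing factor
  \<open>q^(n^2/2)\<close> or its inverse.\<close>

lemma local_weight_eq:
  assumes "cs \<in> flows n" "l < length D"
  shows "local_weight D n l (cs ! l) (cs ! Suc l) =
    eval_at n (turn_factor D (flow_jumps cs) l) *
    (if is_crossing l then s powi ((if elem_at D l = Pos then 1 else - 1) * (int n * int n))
       * eval_at n (crossing_term (\<lambda>l. jump D l (cs ! l) (cs ! Suc l)) l) else 1)"
proof -
  let ?p = "left_width D l" and ?J = "\<lambda>l. jump D l (cs ! l) (cs ! Suc l)"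
  have label: "label D (flow_jumps cs) (time D (l, x, d)) = int (cs ! l ! x)" if "position D (l, x, d)" for l x d
    using label_flow_jumps[OF assms(1) that] .
  have flow: "flow D l (?J l) (cs ! l) (cs ! Suc l)" using assms by (simp add: flows_def)
  have i: "flow_jumps cs = map ?J (crossings D)" by (simp add: flow_jumps_def)
  show ?thesis
  proof (cases "elem_at D l")
    case Pos
    then have c: "is_crossing l" using assms by (simp add: is_crossing_def)
    have a: "label D (flow_jumps cs) (time D (under_position l)) = int (cs ! l ! (?p + 1))"
      and b: "label D (flow_jumps cs) (time D (over_position l)) = int (cs ! l ! ?p)"
      using label crossing_positions[OF c] Pos by (simp_all add: under_position_def over_position_def)
    have "?J l \<le> cs ! l ! ?p" using flow Pos by (simp add: flow_def Let_def)
    from eval_at_pos[OF this, of n "cs ! l ! (?p + 1)"] show ?thesis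
      unfolding crossing_term_def i[symmetric] a b Let_def nat_int
      using Pos c by (simp add: local_weight_def turn_factor_def Let_def)
  next
    case Neg
    then have c: "is_crossing l" using assms by (simp add: is_crossing_def)
    have a: "label D (flow_jumps cs) (time D (under_position l)) = int (cs ! l ! ?p)"
      and b: "label D (flow_jumps cs) (time D (over_position l)) = int (cs ! l ! (?p + 1))"
      using label crossing_positions[OF c] Neg by (simp_all add: under_position_def over_position_def)
    from eval_at_neg[of n "cs ! l ! ?p" "cs ! l ! (?p + 1)" "?J l"] show ?thesis
      unfolding crossing_term_def i[symmetric] a b Let_def nat_int
      using Neg c by (simp add: local_weight_def turn_factor_def Let_def)
  next
    case CapLR
    have "label D (flow_jumps cs) (time D (l, ?p, Up)) = int (cs ! l ! ?p)"
      using cap_right[OF assms(2) CapLR] by (intro label) (rule next_position_positions)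
    then show ?thesis using CapLR
      by (simp add: local_weight_def turn_factor_def is_crossing_def Let_def eval_at_mon weight_def algebra_simps)
  next
    case CupLR
    have "label D (flow_jumps cs) (time D (Suc l, ?p, Down)) = int (cs ! Suc l ! ?p)"
      using cup_right[OF assms(2) CupLR] by (intro label) (rule next_position_positions)
    then show ?thesis using CupLR
      by (simp add: local_weight_def turn_factor_def is_crossing_def Let_def eval_at_mon weight_def algebra_simps)
  qed (simp_all add: local_weight_def turn_factor_def is_crossing_def)
qed

lemma eval_at_state_term:
  assumes "cs \<in> flows n" "writhe D = 0"
  shows "(\<Prod>l<length D. local_weight D n l (cs ! l) (cs ! Suc l)) = eval_at n (state_term D (flow_jumps cs))"
proof -
  let ?J = "\<lambda>l. jump D l (cs ! l) (cs ! Suc l)"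
  let ?\<epsilon> = "\<lambda>l. if elem_at D l = Pos then 1 else - 1 :: int"
  have i: "flow_jumps cs = map ?J (crossings D)" by (simp add: flow_jumps_def)
  have "\<not> (\<exists>t \<le> M. label D (flow_jumps cs) t < 0)"
    using labeling_flow_jumps(2)[OF assms(1)] by (force simp: label_bounded_def)
  then have "state_term D (flow_jumps cs) = (\<Prod>l<length D. turn_factor D (flow_jumps cs) l)
      * (\<Prod>l<length D. if is_crossing l then crossing_term ?J l else 1)"
    unfolding prod_crossing_factor[symmetric] i[symmetric] by (simp only: state_term_def if_False)
  then have state: "eval_at n (state_term D (flow_jumps cs)) =
      (\<Prod>l<length D. eval_at n (turn_factor D (flow_jumps cs) l))
      * (\<Prod>l<length D. if is_crossing l then eval_at n (crossing_term ?J l) else 1)"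
    by (simp add: eval_at.hom_mult eval_at.hom_prod if_distrib[of "eval_at n"]
        cong: if_cong)
  have "(\<Sum>l | is_crossing l. ?\<epsilon> l) = 0"
    using assms(2) by (simp add: writhe_def sum_list_distinct_conv_sum_set distinct_crossings set_crossings)
  then have "(\<Sum>l | is_crossing l. ?\<epsilon> l * (int n * int n)) = 0"
    by (simp only: sum_distrib_right[symmetric] mult_zero_left)
  then have "(\<Prod>l | is_crossing l. s powi (?\<epsilon> l * (int n * int n))) = 1"
    using prod_powi[OF finite_crossings, of "\<lambda>l. ?\<epsilon> l * (int n * int n)"] by simp
  also have "(\<Prod>l | is_crossing l. s powi (?\<epsilon> l * (int n * int n)))
      = (\<Prod>l<length D. if is_crossing l then s powi (?\<epsilon> l * (int n * int n)) else 1)"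
    by (rule prod.mono_neutral_cong_left) (auto simp: is_crossing_def)
  finally have framing: "(\<Prod>l<length D. if is_crossing l then s powi (?\<epsilon> l * (int n * int n)) else 1) = 1" .
  have "(\<Prod>l<length D. local_weight D n l (cs ! l) (cs ! Suc l)) =
      (\<Prod>l<length D. (if is_crossing l then s powi (?\<epsilon> l * (int n * int n)) else 1)
        * (eval_at n (turn_factor D (flow_jumps cs) l)
          * (if is_crossing l then eval_at n (crossing_term ?J l) else 1)))"
    by (intro prod.cong refl) (simp add: local_weight_eq[OF assms(1)] mult_ac)
  then show ?thesis unfolding prod.distrib framing state by simp
qed

lemma RT_mat_state_terms:
  assumes "writhe D = 0"
  shows "RT_mat s n D $$ (0, 0) = (\<Sum>i\<in>label_bounded n. eval_at n (state_term D i))"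
  unfolding RT_mat_flows
  by (rule sum.reindex_bij_witness[of _ labeling flow_jumps])
     (simp_all add: labeling_flow_jumps flow_jumps_labeling eval_at_state_term assms)

text \<open>
  On the way from a label at most \<open>n\<close> to a larger one, the strand runs under a crossing with
  $a_k \<le> n < a_k + i_k$, whose factor vanishes at $A = q^n$.
\<close>

lemma eval_at_state_term_eq_0:
  assumes "length i = length (crossings D)" "i \<notin> label_bounded n"
  shows "eval_at n (state_term D i) = 0"
proof (cases "\<exists>t \<le> M. label D i t < 0")
  case True
  then show ?thesis by (simp add: state_term_def)
next
  case False
  then have nonneg: "label D i t \<ge> 0" if "t \<le> M" for t using that by force
  \<comment> \<open>The crossings are distinct, so any list of the right length comes from a
    function on layers.\<close>
  define J where "J = the \<circ> map_of (zip (crossings D) i)"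
  have i: "i = map J (crossings D)"
    by (rule nth_equalityI) (use assms(1) in \<open>simp_all add: J_def map_of_zip_nth distinct_crossings\<close>)
  have "\<exists>t \<le> M. int n < label D i t"
  proof (rule ccontr)
    assume "\<not> ?thesis"
    then have "\<forall>t \<le> M. 0 \<le> label D i t \<and> label D i t \<le> int n" using nonneg by force
    then show False using assms(2) i by (auto simp: label_bounded_def)
  qed
  \<comment> \<open>The first time at which the label exceeds \<open>n\<close>; it is not
    \<open>0\<close>, since the strand starts with label \<open>0\<close>.\<close>
  then obtain u where u: "u \<le> M" "int n < label D i u" "\<And>t. t < u \<Longrightarrow> label D i t \<le> int n"
    using exists_least_iff[of "\<lambda>t. t \<le> M \<and> int n < label D i t"] by (metis le_trans less_imp_le not_less)
  then obtain t where t: "u = Suc t" by (cases u) (auto simp: label_0)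
  define st where "st = visit D t"
  have "next_position D st (visit D u)" using next_visit_less[of t] u t by (simp add: st_def)
  from label_next[OF this, of J] have change: "label D i u = label D i t + label_change J st"
    using time_visit[of t] time_visit[of u] u t by (simp add: i st_def)
  have small: "label D i t \<le> int n" using u t by simp
  then have "label_change J st > 0" using change u by simp
  \<comment> \<open>A label grows only on an under-pass.\<close>
  then obtain l where l: "is_crossing l" "st = under_position l" "label_change J st \<le> int (J l)"
    by (cases "is_crossing (fst st)"; cases "st = under_position (fst st)";
        cases "st = over_position (fst st)")
       (auto simp: label_change_def mult_le_cancel_left2 split: if_splits)
  have a: "label D i (time D (under_position l)) = label D i t"
    using l time_visit[of t] u t by (simp add: st_def)
  define b where "b = nat (label D i t)"
  have b: "label D i t = int b" using nonneg[of t] u t by (simp add: b_def)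
  have "eval_at n (abrace (- int b) (J l)) = 0"
    using small change l u b by (intro eval_at_abrace_eq_0) auto
  then have "eval_at n (crossing_term J l) = 0"
    unfolding crossing_term_def i[symmetric] a b Let_def by (simp add: eval_at.hom_mult)
  then have "eval_at n (\<Prod>l<length D. if is_crossing l then crossing_term J l else 1) = 0"
    using l(1) unfolding eval_at.hom_prod
    by (intro prod_zero) (auto simp: is_crossing_def intro!: bexI[of _ l])
  then have "eval_at n (\<Prod>k<length (crossings D). crossing_factor D i k) = 0"
    by (simp only: i prod_crossing_factor)
  then show ?thesis using False by (simp only: state_term_def if_False eval_at.hom_mult mult_zero_right)
qed

end

text \<open>Different exponents give different exponentials, so \<open>e^(kh)\<close> and
  \<open>e^(-kh)\<close> differ for \<open>k > 0\<close>.\<close>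

lemma generic_q_fls_exp: "generic_q (fls_exp (1 / 2))"
proof
  fix k :: int assume "k > 0"
  then show "fls_exp (1 / 2) powi (2 * k) \<noteq> fls_exp (1 / 2) powi (- 2 * k)"
    unfolding fls_exp_powi fls_exp_eq_iff by simp
qed simp

theorem proposition68:
  fixes D :: diagram and P :: "nat \<Rightarrow> rat laurent"
  assumes "knot_diagram D"
    and "writhe D = 0"
    and "loop_polynomials D P"
  shows "J_alpha D P = R_hat_to_fps (F_infty D)"
proof (rule sym, rule R_hat_to_fps_eqI[OF F_infty_in_R_hat])
  interpret q: generic_q "fls_exp (1 / 2)" by (rule generic_q_fls_exp)
  interpret knot_sum D "fls_exp (1 / 2)" by standard (rule assms(1))
  have eval_at: "q.eval_at c = (\<lambda>f. fps_to_fls (spec c f))" for c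
    by (simp add: q.eval_at_def spec_eq_qA_eval fls_exp_powi fun_eq_iff del: power_int_numeral)
  fix c n x m assume x: "x \<in> F_infty D n" and m: "m < n"
  let ?S = "{i. length i = length (crossings D) \<and> state_term D i \<notin> I_ideal n}"
  let ?T = "label_bounded c"
  \<comment> \<open>At \<open>\<alpha> = c\<close> the loop series is the scalar by which the
    operator acts, and a diagonal entry reads it off. The entry at \<open>v_0\<close> is the one
    with label \<open>0\<close> at both ends.\<close>
  have "fps_to_fls (fps_eval c (J_alpha D P)) = RT_mat (fls_exp (1 / 2)) c D $$ (0, 0)"
    using assms(3) by (simp add: loop_polynomials_def colored_jones_def fps_eval_J_alpha fls_exp_def)
  also have "\<dots> = fps_to_fls (\<Sum>i\<in>?T. spec c (state_term D i))"
    by (simp add: RT_mat_state_terms assms(2) eval_at fps_to_fls_sum)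
  finally have J: "fps_eval c (J_alpha D P) = (\<Sum>i\<in>?T. spec c (state_term D i))"
    by (simp only: fps_to_fls_eq_iff)
  have len: "length i = length (crossings D)" if "i \<in> ?T" for i
    using that by (auto simp: label_bounded_def)
  \<comment> \<open>The index sets \<open>?T\<close> and \<open>?S\<close> differ in both
    directions. A term in \<open>?T\<close> outside \<open>?S\<close> lies in \<open>I_n\<close> and
    vanishes below degree \<open>n\<close>.\<close>
  have "(\<Sum>i\<in>?T. fps_nth (spec c (state_term D i)) m)
      = (\<Sum>i\<in>?S \<inter> ?T. fps_nth (spec c (state_term D i)) m)"
    by (rule sum.mono_neutral_right[OF finite_label_bounded])
       (use m len in \<open>auto intro: fps_nth_spec_I_ideal\<close>)
  also have "\<dots> = (\<Sum>i\<in>?S. fps_nth (spec c (state_term D i)) m)"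
  proof (rule sum.mono_neutral_left[OF finite_state_terms])
    \<comment> \<open>Conversely, a term in \<open>?S\<close> outside \<open>?T\<close> has a label
      that is negative or exceeds \<open>c\<close>, and it vanishes at \<open>A = q^c\<close> to all
      orders in \<open>h\<close>.\<close>
    have "spec c (state_term D i) = 0" if "i \<in> ?S - ?T" for i
      using eval_at_state_term_eq_0[of i c] that by (simp add: eval_at)
    moreover have "?S - ?S \<inter> ?T = ?S - ?T" by blast
    ultimately show "\<forall>i\<in>?S - ?S \<inter> ?T. fps_nth (spec c (state_term D i)) m = 0" by simp
  qed simp
  also have "\<dots> = fps_nth (spec c (\<Sum>i\<in>?S. state_term D i)) m"
    by (simp add: spec.hom_sum fps_sum_nth)
  also have "\<dots> = fps_nth (spec c x) m"
    using spec_coset[OF x[unfolded F_infty_def] m] by simp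
  finally show "fps_nth (fps_eval c (J_alpha D P)) m = fps_nth (spec c x) m"
    by (simp add: J fps_sum_nth)
qed

end
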